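(* Let $(X,\sigma_X)$, $(Y,\sigma_Y)$ be one-sided subshifts and $\pi:X\to Y$ a (one-block) factor map, and suppose $X$ has the specification property. Let $\mathcal F=\{\log f_n\}_{n=1}^\infty$ be an almost additive potential on $X$ with bounded variation, let $\mu\in M(X,\sigma_X)$ be the unique invariant Gibbs measure for $\mathcal F$, and let $\nu=\pi\mu$. Then $\mathcal G=\{\log g_n\}_{n=1}^\infty$ is an asymptotically subadditive potential on $Y$ with bounded variation, $\nu$ is the unique invariant Gibbs measure for $\mathcal G$, $\nu$ is the unique equilibrium state for $\mathcal G$, $\nu$ is mixing, and $$P_X(\mathcal F)=\sup_{\bar\mu\in M(X,\sigma_X)}\Big\{h_{\bar\mu}(\sigma_X)+\lim_{n\to\infty}\tfrac1n\int\log f_n\,d\bar\mu\Big\}=\sup_{\bar\nu\in M(Y,\sigma_Y)}\Big\{h_{\bar\nu}(\sigma_Y)+\lim_{n\to\infty}\tfrac1n\int\log g_n\,d\bar\nu\Big\}=P_Y(\mathcal G).$$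
   Context: A one-sided subshift $(X,\sigma_X)$ is a closed set $X\subseteq\{1,\dots,k\}^{\mathbb N}$ with $\sigma_X(X)\subseteq X$, where $\sigma_X((x_n)_{n\ge1})=(x_{n+1})_{n\ge1}$; the metric is $d(x,x')=2^{-j}$ where $j$ is the largest integer with $x_i=x'_i$ for $1\le i\le j$ ($d=1$ if $x_1\neq x'_1$, $d=0$ if $x=x'$). $B_n(X)$ is the set of words of length $n$ occurring in points of $X$; $[x_1\cdots x_n]=\{x'\in X:x'_i=x_i,1\le i\le n\}$. $X$ has the specification property if there is $p>0$ such that for any allowable words $u,v$ there is a word $w$ of length $p$ with $uwv$ allowable. A factor map is a continuous surjection $\pi:X\to Y$ with $\pi\circ\sigma_X=\sigma_Y\circ\pi$; it is assumed one-block ($\pi(x)_i$ depends only on $x_i$), so it acts letterwise on words. $M(X,\sigma_X)$ denotes the invariant Borel probability measures, $h_\mu$ the entropy, $\pi\mu=\mu\circ\pi^{-1}$. A sequence $\Phi=\{\log\phi_n\}$ of continuous $\phi_n:X\to(0,\infty)$ is subadditive if $\phi_{n+m}(x)\le\phi_n(x)\phi_m(\sigma_X^nx)$ for all $x,n,m$; almost additive if there is $C>0$ with $e^{-C}\phi_n(x)\phi_m(\sigma_X^nx)\le\phi_{n+m}(x)\le e^{C}\phi_n(x)\phi_m(\sigma_X^nx)$ for all $x,n,m$; asymptotically subadditive if for every $\epsilon>0$ there is a subadditive $\{\log\psi_n\}$ with $\limsup_n\frac1n\sup_x|\log\phi_n(x)-\log\psi_n(x)|\le\epsilon$. $\Phi$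 has bounded variation if $\sup_n\sup\{\phi_n(x)/\phi_n(x'):x_i=x'_i,1\le i\le n\}<\infty$. The pressure is $P_X(\Phi)=\lim_{\epsilon\to0}\limsup_n\frac1n\log\sup_E\sum_{x\in E}\phi_n(x)$, the sup over $(n,\epsilon)$-separated sets $E$ (distinct $x,y\in E$ have $\max_{0\le i<n}d(\sigma^ix,\sigma^iy)>\epsilon$). For asymptotically subadditive $\Phi$ the variational principle $P_X(\Phi)=\sup_\mu\{h_\mu+\lim_n\frac1n\int\log\phi_nd\mu\}$ holds; an equilibrium state is a $\mu\in M(X,\sigma_X)$ attaining the sup. A Borel probability measure $\mu$ is a Gibbs measure for $\Phi$ if there is $C_0>0$ with $C_0^{-1}<\mu([x_1\cdots x_n])/(e^{-nP_X(\Phi)}\phi_n(x))<C_0$ for all $x\in X$, $n\in\mathbb N$. (Known: if $X$ has specification and $\Phi$ is almost additive with bounded variation, there is a unique invariant Gibbs measure for $\Phi$.) Construction: for $y\in Y$ and $n\in\mathbb N$, $E_n(y)$ denotes any set consisting of exactly one point from each cylinder $[x_1\cdots x_n]$ of $X$ with $\pi([x_1\cdots x_n])\subseteq[y_1\cdots y_n]$, and $g_n(y)=\sup_{E_n(y)}\sum_{x\in E_n(y)}f_n(x)$, the supremum over all such choices of $E_n(y)$; $\mathcal G=\{\log g_n\}_{n\ge1}$. *)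

theory Defs
  imports "HOL-Probability.Probability"
begin

text \<open>Points of a one-sided subshift are sequences \<open>nat \<Rightarrow> nat\<close>; the paper's coordinate
  \<open>x_i\<close> (i \<ge> 1) is \<open>x (i - 1)\<close>.  The topology on \<open>nat \<Rightarrow> nat\<close> is the product topology,
  which on sequences over a finite alphabet is the topology of the metric \<open>d\<close> below.\<close>

definition shift :: "(nat \<Rightarrow> nat) \<Rightarrow> (nat \<Rightarrow> nat)" where
  "shift x = (\<lambda>i. x (Suc i))"

definition shiftn :: "nat \<Rightarrow> (nat \<Rightarrow> nat) \<Rightarrow> (nat \<Rightarrow> nat)" where
  "shiftn n x = (\<lambda>i. x (i + n))"

definition subshift :: "nat \<Rightarrow> (nat \<Rightarrow> nat) set \<Rightarrow> bool" where
  "subshift k X \<longleftrightarrow> closed X \<and> X \<subseteq> {x. \<forall>i. x i \<in> {1..k}} \<and> shift ` X \<subseteq> X"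

definition dX :: "(nat \<Rightarrow> nat) \<Rightarrow> (nat \<Rightarrow> nat) \<Rightarrow> real" where
  "dX x y = (if x = y then 0 else (1/2) ^ (LEAST i. x i \<noteq> y i))"

definition words :: "(nat \<Rightarrow> nat) set \<Rightarrow> nat \<Rightarrow> nat list set" where
  "words X n = {w. length w = n \<and> (\<exists>x\<in>X. \<forall>i<n. x i = w ! i)}"

definition language :: "(nat \<Rightarrow> nat) set \<Rightarrow> nat list set" where
  "language X = (\<Union>n. words X n)"

definition cyl :: "(nat \<Rightarrow> nat) set \<Rightarrow> nat list \<Rightarrow> (nat \<Rightarrow> nat) set" where
  "cyl X w = {x\<in>X. \<forall>i<length w. x i = w ! i}"

definition prefix :: "(nat \<Rightarrow> nat) \<Rightarrow> nat \<Rightarrow> nat list" where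
  "prefix x n = map x [0..<n]"

definition has_specification :: "(nat \<Rightarrow> nat) set \<Rightarrow> bool" where
  "has_specification X \<longleftrightarrow> (\<exists>p>0. \<forall>u\<in>language X. \<forall>v\<in>language X.
      \<exists>w. length w = p \<and> u @ w @ v \<in> language X)"

definition factor_map :: "(nat \<Rightarrow> nat) set \<Rightarrow> (nat \<Rightarrow> nat) set \<Rightarrow> ((nat \<Rightarrow> nat) \<Rightarrow> (nat \<Rightarrow> nat)) \<Rightarrow> bool" where
  "factor_map X Y \<pi> \<longleftrightarrow> continuous_on X \<pi> \<and> \<pi> ` X = Y \<and> (\<forall>x\<in>X. \<pi> (shift x) = shift (\<pi> x))
     \<and> (\<exists>\<tau>::nat \<Rightarrow> nat. \<forall>x\<in>X. \<pi> x = \<tau> \<circ> x)"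

definition potential :: "(nat \<Rightarrow> nat) set \<Rightarrow> (nat \<Rightarrow> (nat \<Rightarrow> nat) \<Rightarrow> real) \<Rightarrow> bool" where
  "potential X \<phi> \<longleftrightarrow> (\<forall>n\<ge>1. continuous_on X (\<phi> n) \<and> (\<forall>x\<in>X. \<phi> n x > 0))"

definition subadditive :: "(nat \<Rightarrow> nat) set \<Rightarrow> (nat \<Rightarrow> (nat \<Rightarrow> nat) \<Rightarrow> real) \<Rightarrow> bool" where
  "subadditive X \<phi> \<longleftrightarrow> potential X \<phi> \<and>
     (\<forall>x\<in>X. \<forall>n\<ge>1. \<forall>m\<ge>1. \<phi> (n + m) x \<le> \<phi> n x * \<phi> m (shiftn n x))"

definition almost_additive :: "(nat \<Rightarrow> nat) set \<Rightarrow> (nat \<Rightarrow> (nat \<Rightarrow> nat) \<Rightarrow> real) \<Rightarrow> bool" where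
  "almost_additive X \<phi> \<longleftrightarrow> potential X \<phi> \<and> (\<exists>C>0.
     \<forall>x\<in>X. \<forall>n\<ge>1. \<forall>m\<ge>1.
       exp (- C) * \<phi> n x * \<phi> m (shiftn n x) \<le> \<phi> (n + m) x \<and>
       \<phi> (n + m) x \<le> exp C * \<phi> n x * \<phi> m (shiftn n x))"

definition asymp_subadditive :: "(nat \<Rightarrow> nat) set \<Rightarrow> (nat \<Rightarrow> (nat \<Rightarrow> nat) \<Rightarrow> real) \<Rightarrow> bool" where
  "asymp_subadditive X \<phi> \<longleftrightarrow> potential X \<phi> \<and> (\<forall>\<epsilon>>0. \<exists>\<psi>. subadditive X \<psi> \<and>
     limsup (\<lambda>n. ereal ((SUP x\<in>X. \<bar>ln (\<phi> n x) - ln (\<psi> n x)\<bar>) / real n)) \<le> ereal \<epsilon>)"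

definition bounded_variation :: "(nat \<Rightarrow> nat) set \<Rightarrow> (nat \<Rightarrow> (nat \<Rightarrow> nat) \<Rightarrow> real) \<Rightarrow> bool" where
  "bounded_variation X \<phi> \<longleftrightarrow> (\<exists>B. \<forall>n\<ge>1. \<forall>x\<in>X. \<forall>x'\<in>X.
     (\<forall>i<n. x i = x' i) \<longrightarrow> \<phi> n x / \<phi> n x' \<le> B)"

definition separated :: "(nat \<Rightarrow> nat) set \<Rightarrow> nat \<Rightarrow> real \<Rightarrow> (nat \<Rightarrow> nat) set \<Rightarrow> bool" where
  "separated X n \<epsilon> E \<longleftrightarrow> E \<subseteq> X \<and> finite E \<and>
     (\<forall>x\<in>E. \<forall>y\<in>E. x \<noteq> y \<longrightarrow> (\<exists>i<n. dX (shiftn i x) (shiftn i y) > \<epsilon>))"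

definition pressure :: "(nat \<Rightarrow> nat) set \<Rightarrow> (nat \<Rightarrow> (nat \<Rightarrow> nat) \<Rightarrow> real) \<Rightarrow> ereal" where
  "pressure X \<phi> = Lim (at_right (0::real)) (\<lambda>\<epsilon>.
     limsup (\<lambda>n. ereal (ln (SUP E\<in>{E. separated X n \<epsilon> E}. (\<Sum>x\<in>E. \<phi> n x)) / real n)))"

definition borel_on :: "(nat \<Rightarrow> nat) set \<Rightarrow> (nat \<Rightarrow> nat) measure" where
  "borel_on X = restrict_space borel X"

definition borel_prob :: "(nat \<Rightarrow> nat) set \<Rightarrow> (nat \<Rightarrow> nat) measure set" where
  "borel_prob X = {\<mu>. prob_space \<mu> \<and> sets \<mu> = sets (borel_on X)}"

definition invariant_measures :: "(nat \<Rightarrow> nat) set \<Rightarrow> (nat \<Rightarrow> nat) measure set" where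
  "invariant_measures X = {\<mu>\<in>borel_prob X.
     \<forall>A\<in>sets \<mu>. emeasure \<mu> (shift -` A \<inter> X) = emeasure \<mu> A}"

text \<open>measure-theoretic entropy of an invariant measure on a subshift
  (computed with the generating partition into 1-cylinders)\<close>
definition entropy_ms :: "(nat \<Rightarrow> nat) set \<Rightarrow> (nat \<Rightarrow> nat) measure \<Rightarrow> real" where
  "entropy_ms X \<mu> = lim (\<lambda>n. - (\<Sum>w\<in>words X n. measure \<mu> (cyl X w) * ln (measure \<mu> (cyl X w))) / real n)"

definition free_energy :: "(nat \<Rightarrow> nat) set \<Rightarrow> (nat \<Rightarrow> (nat \<Rightarrow> nat) \<Rightarrow> real) \<Rightarrow> (nat \<Rightarrow> nat) measure \<Rightarrow> ereal" where
  "free_energy X \<phi> \<mu> = ereal (entropy_ms X \<mu>) +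
     Lim sequentially (\<lambda>n. ereal ((\<integral>x. ln (\<phi> n x) \<partial>\<mu>) / real n))"

definition var_sup :: "(nat \<Rightarrow> nat) set \<Rightarrow> (nat \<Rightarrow> (nat \<Rightarrow> nat) \<Rightarrow> real) \<Rightarrow> ereal" where
  "var_sup X \<phi> = (SUP \<mu>\<in>invariant_measures X. free_energy X \<phi> \<mu>)"

definition equilibrium_state :: "(nat \<Rightarrow> nat) set \<Rightarrow> (nat \<Rightarrow> (nat \<Rightarrow> nat) \<Rightarrow> real) \<Rightarrow> (nat \<Rightarrow> nat) measure \<Rightarrow> bool" where
  "equilibrium_state X \<phi> \<mu> \<longleftrightarrow> \<mu> \<in> invariant_measures X \<and> free_energy X \<phi> \<mu> = var_sup X \<phi>"

definition gibbs :: "(nat \<Rightarrow> nat) set \<Rightarrow> (nat \<Rightarrow> (nat \<Rightarrow> nat) \<Rightarrow> real) \<Rightarrow> (nat \<Rightarrow> nat) measure \<Rightarrow> bool" where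
  "gibbs X \<phi> \<mu> \<longleftrightarrow> \<mu> \<in> borel_prob X \<and> \<bar>pressure X \<phi>\<bar> \<noteq> \<infinity> \<and>
     (\<exists>C0>0. \<forall>x\<in>X. \<forall>n\<ge>1.
        1 / C0 < measure \<mu> (cyl X (prefix x n)) / (exp (- real n * real_of_ereal (pressure X \<phi>)) * \<phi> n x) \<and>
        measure \<mu> (cyl X (prefix x n)) / (exp (- real n * real_of_ereal (pressure X \<phi>)) * \<phi> n x) < C0)"

definition mixing :: "(nat \<Rightarrow> nat) set \<Rightarrow> (nat \<Rightarrow> nat) measure \<Rightarrow> bool" where
  "mixing X \<mu> \<longleftrightarrow> (\<forall>A\<in>sets \<mu>. \<forall>B\<in>sets \<mu>.
     (\<lambda>n. measure \<mu> (A \<inter> (shiftn n -` B \<inter> X))) \<longlonglongrightarrow> measure \<mu> A * measure \<mu> B)"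

text \<open>the potential \<G> = {log g_n}: E_n(y) picks one point e w from each cylinder [w]
  of X (w \<in> B_n(X)) with \<pi>([w]) \<subseteq> [y_1..y_n]; g_n(y) is the sup over such choices\<close>
definition fiber_words :: "(nat \<Rightarrow> nat) set \<Rightarrow> (nat \<Rightarrow> nat) set \<Rightarrow> ((nat \<Rightarrow> nat) \<Rightarrow> (nat \<Rightarrow> nat))
    \<Rightarrow> nat \<Rightarrow> (nat \<Rightarrow> nat) \<Rightarrow> nat list set" where
  "fiber_words X Y \<pi> n y = {w\<in>words X n. \<pi> ` cyl X w \<subseteq> cyl Y (prefix y n)}"

definition gpot :: "(nat \<Rightarrow> nat) set \<Rightarrow> (nat \<Rightarrow> nat) set \<Rightarrow> ((nat \<Rightarrow> nat) \<Rightarrow> (nat \<Rightarrow> nat))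
    \<Rightarrow> (nat \<Rightarrow> (nat \<Rightarrow> nat) \<Rightarrow> real) \<Rightarrow> nat \<Rightarrow> (nat \<Rightarrow> nat) \<Rightarrow> real" where
  "gpot X Y \<pi> f n y = (SUP e\<in>(\<Pi> w\<in>fiber_words X Y \<pi> n y. cyl X w).
      (\<Sum>w\<in>fiber_words X Y \<pi> n y. f n (e w)))"

end

theory Submission
  imports Defs "HOL-Complex_Analysis.Great_Picard"
begin

text \<open>By the Gibbs property, almost additivity and
  specification, the cylinder function \<open>m w = \<mu> [w]\<close> satisfies \<open>m (u v) \<le> K m u m v\<close> and
  \<open>(\<Sum>|w| = p. m (u w v)) \<ge> c m u m v\<close>; both bounds pass to \<open>\<nu>\<close> by summing over fibres, and so does
  the Gibbs property, with \<open>g\<close> in place of \<open>f\<close> and the same constant \<open>P = P\<^sub>X(\<F>)\<close>. These properties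
  of a single measure imply everything that is claimed about it. The key step is that an invariant
  process whose relative entropies with respect to \<open>m\<close> on words of length \<open>n\<close> are bounded in \<open>n\<close>
  equals \<open>m\<close>. It applies to Gibbs measures (bounded density), to equilibrium states \<open>\<eta>\<close> (by
  subadditivity of entropy and of \<open>\<Sum>w. \<eta> [w] ln m w\<close>, the relative entropy is at most \<open>ln K\<close>), and to
  the limit points of the laws of \<open>(x, \<sigma>\<^sup>n x)\<close> on pairs (dominated by \<open>K m \<times> m\<close>), which gives
  mixing.\<close>

section \<open>Shift-invariant processes on words\<close>

text \<open>On \<open>X\<close> the measure of \<open>u @ v\<close> is comparable to the product of
  the measures in both directions as soon as the concatenation is allowed. This conditional lower
  bound is lost in the factor: two words of \<open>Y\<close> may concatenate although only few pairs
  of words in their fibres do, so no uniform lower bound for adjacent words is available there. What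
  survives summation over fibres is an inequality that holds for all pairs of words and is bilinear
  in their measures: the upper bound for adjacent words, and the lower bound after a free gap of
  fixed length \<open>p\<close>.

  The argument is about functions on words over an arbitrary finite alphabet rather than about
  measures, because the limit points used for mixing are processes over \<open>A \<times> A\<close>
  obtained as pointwise limits of word functions. Relative entropy enters because a competing
  equilibrium state is not known in advance to have a bounded density; estimates at finite length
  only bound its mean logarithm.\<close>

definition wlists :: "'a set \<Rightarrow> nat \<Rightarrow> 'a list set" where
  "wlists A n = {w. set w \<subseteq> A \<and> length w = n}"

lemma finite_wlists: "finite A \<Longrightarrow> finite (wlists A n)"
  unfolding wlists_def by (rule finite_lists_length_eq)

lemma card_wlists: "finite A \<Longrightarrow> card (wlists A n) = card A ^ n"
  unfolding wlists_def by (rule card_lists_length_eq)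

lemma wlists_0 [simp]: "wlists A 0 = {[]}"
  by (auto simp: wlists_def)

lemma in_wlists_lists: "w \<in> wlists A n \<Longrightarrow> w \<in> lists A"
  by (auto simp: wlists_def)

lemma wlists_length: "w \<in> wlists A n \<Longrightarrow> length w = n"
  by (auto simp: wlists_def)

lemma lists_in_wlists: "w \<in> lists A \<Longrightarrow> w \<in> wlists A (length w)"
  by (auto simp: wlists_def)

lemma sum_wlists_add:
  "(\<Sum>w\<in>wlists A (i + j). h w) = (\<Sum>u\<in>wlists A i. \<Sum>v\<in>wlists A j. h (u @ v))"
proof -
  have "(\<Sum>u\<in>wlists A i. \<Sum>v\<in>wlists A j. h (u @ v))
      = (\<Sum>(u, v)\<in>wlists A i \<times> wlists A j. h (u @ v))"
    by (rule sum.cartesian_product)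
  also have "\<dots> = (\<Sum>w\<in>wlists A (i + j). h w)"
    by (rule sum.reindex_bij_witness[where i = "\<lambda>w. (take i w, drop i w)" and j = "\<lambda>(u, v). u @ v"])
       (auto simp: wlists_def dest: in_set_takeD in_set_dropD)
  finally show ?thesis by simp
qed

lemma sum_wlists_1: "(\<Sum>w\<in>wlists A (Suc 0). h w) = (\<Sum>a\<in>A. h [a])"
  by (rule sum.reindex_bij_witness[where i = "\<lambda>a. [a]" and j = hd])
     (auto simp: wlists_def length_Suc_conv)

text \<open>Word probabilities of a stationary process: \<open>m_snoc\<close> is Kolmogorov
  consistency, \<open>m_Cons\<close> is stationarity. The alphabet is a finite set of any type, so
  that pairs of letters are covered.\<close>

locale shift_process =
  fixes A :: "'a set" and m :: "'a list \<Rightarrow> real"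
  assumes finite_A: "finite A"
    and m_Nil: "m [] = 1"
    and m_nonneg: "\<And>w. 0 \<le> m w"
    and m_snoc: "\<And>w. w \<in> lists A \<Longrightarrow> (\<Sum>a\<in>A. m (w @ [a])) = m w"
    and m_Cons: "\<And>w. w \<in> lists A \<Longrightarrow> (\<Sum>a\<in>A. m (a # w)) = m w"
begin

lemma sum_append_right: "w \<in> lists A \<Longrightarrow> (\<Sum>v\<in>wlists A n. m (w @ v)) = m w"
proof (induction n arbitrary: w)
  case (Suc n)
  have "(\<Sum>v\<in>wlists A (Suc 0 + n). m (w @ v)) = (\<Sum>a\<in>A. \<Sum>v\<in>wlists A n. m ((w @ [a]) @ v))"
    by (simp only: sum_wlists_add sum_wlists_1 append_assoc)
  also have "\<dots> = (\<Sum>a\<in>A. m (w @ [a]))"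
    by (intro sum.cong refl Suc.IH) (use Suc.prems in auto)
  finally show ?case using m_snoc[OF Suc.prems] by simp
qed simp

lemma sum_append_left: "w \<in> lists A \<Longrightarrow> (\<Sum>v\<in>wlists A n. m (v @ w)) = m w"
proof (induction n arbitrary: w)
  case (Suc n)
  have "(\<Sum>v\<in>wlists A (n + Suc 0). m (v @ w)) = (\<Sum>v\<in>wlists A n. \<Sum>a\<in>A. m (v @ a # w))"
    by (simp only: sum_wlists_add sum_wlists_1 append_assoc append_Cons append_Nil)
  also have "\<dots> = (\<Sum>a\<in>A. \<Sum>v\<in>wlists A n. m (v @ a # w))" by (rule sum.swap)
  also have "\<dots> = (\<Sum>a\<in>A. m (a # w))"
    using Suc by (intro sum.cong) auto
  finally show ?case using m_Cons[OF Suc.prems] by simp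
qed simp

lemma sum_wlists: "(\<Sum>w\<in>wlists A n. m w) = 1"
  using sum_append_right[of "[]" n] by (simp add: m_Nil)

lemma append_le: "w \<in> lists A \<Longrightarrow> v \<in> lists A \<Longrightarrow> m (w @ v) \<le> m w"
  using member_le_sum[of v "wlists A (length v)" "\<lambda>v. m (w @ v)"]
  by (simp add: sum_append_right m_nonneg finite_wlists finite_A lists_in_wlists)

lemma le_one: "w \<in> lists A \<Longrightarrow> m w \<le> 1"
  using append_le[of "[]" w] by (simp add: m_Nil)

end

text \<open>With \<open>ln 0 = 0\<close> and \<open>x / 0 = 0\<close>, a word with
  \<open>m w = 0 < l w\<close> contributes 0 instead of infinity; the lemmas below therefore assume
  the absolute continuity \<open>ac\<close>.\<close>

definition rel_ent :: "'a set \<Rightarrow> ('a list \<Rightarrow> real) \<Rightarrow> ('a list \<Rightarrow> real) \<Rightarrow> nat \<Rightarrow> real" where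
  "rel_ent A l m n = (\<Sum>w\<in>wlists A n. l w * ln (l w / m w))"

text \<open>The integrand of relative entropy, normalised by \<open>- p + q\<close> to be
  nonnegative, dominates the Hellinger integrand: this is \<open>ln s \<le> s - 1\<close> at
  \<open>s = sqrt (q / p)\<close>.\<close>

lemma kl_sqrt_bound:
  fixes p q :: real
  assumes "0 \<le> p" "0 \<le> q" "q = 0 \<Longrightarrow> p = 0"
  shows "(sqrt q - sqrt p)\<^sup>2 \<le> p * ln (p / q) - p + q"
proof (cases "p = 0")
  case False
  then have p: "p > 0" and q: "q > 0" using assms by (cases "q = 0"; force)+
  define s where "s = sqrt (q / p)"
  have s: "s > 0" "s\<^sup>2 = q / p" using p q by (auto simp: s_def)
  have "ln (p / q) = - ln (s\<^sup>2)" using p q s by (simp add: ln_div)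
  also have "\<dots> = - 2 * ln s" using ln_realpow[of s 2] by simp
  also have "\<dots> \<ge> - 2 * (s - 1)" using ln_le_minus_one[OF s(1)] by simp
  finally have "p * ln (p / q) \<ge> p * (- 2 * (s - 1))" using p by (intro mult_left_mono) auto
  moreover have "p * s = sqrt p * sqrt q"
    using p q unfolding s_def real_sqrt_divide
    by (metis (no_types, lifting) less_eq_real_def mult.commute real_div_sqrt times_divide_eq_left times_divide_eq_right)
  moreover have "(sqrt q - sqrt p)\<^sup>2 = q + p - 2 * (sqrt p * sqrt q)"
    using p q by (simp add: power2_diff)
  ultimately show ?thesis by (simp add: algebra_simps)
qed (use assms in auto)

lemma kl_nonneg:
  fixes p q :: real
  assumes "0 \<le> p" "0 \<le> q" "q = 0 \<Longrightarrow> p = 0"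
  shows "0 \<le> p * ln (p / q) - p + q"
  using kl_sqrt_bound[OF assms] zero_le_power2[of "sqrt q - sqrt p"] by linarith

text \<open>A linear substitute for Pinsker's inequality: the free weight \<open>e\<close> avoids
  the square root, so the estimate can be summed term by term over any event.\<close>

lemma kl_pointwise:
  fixes p q e :: real
  assumes "0 \<le> p" "0 \<le> q" "q = 0 \<Longrightarrow> p = 0" "e > 0"
  shows "q - p \<le> e * q + (p * ln (p / q) - p + q) / e"
proof -
  define a b where "a = sqrt q" and "b = sqrt p"
  have ab: "a \<ge> 0" "b \<ge> 0" "q = a\<^sup>2" "p = b\<^sup>2" using assms by (auto simp: a_def b_def)
  have "q - p \<le> 2 * a * (a - b)" 
    using zero_le_power2[of "a - b"] by (simp add: ab power2_eq_square algebra_simps)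
  also have "\<dots> \<le> e * a\<^sup>2 + (a - b)\<^sup>2 / e"
  proof -
    have "0 \<le> (e * a - (a - b))\<^sup>2 / e" using assms by simp
    also have "\<dots> = e * a\<^sup>2 + (a - b)\<^sup>2 / e - 2 * a * (a - b)"
      using assms by (simp add: field_simps power2_eq_square)
    finally show ?thesis by simp
  qed
  also have "(a - b)\<^sup>2 / e \<le> (p * ln (p / q) - p + q) / e"
    using kl_sqrt_bound[OF assms(1-3)] assms(4) by (simp add: divide_right_mono a_def b_def)
  finally show ?thesis by (simp add: ab)
qed

text \<open>The relative entropy gained between lengths \<open>N\<close> and \<open>N + j\<close> controls the distance of \<open>l\<close>
  to the process that has the law of \<open>l\<close> on the first \<open>N\<close> letters and continues like \<open>m\<close>.\<close>

lemma rel_ent_increment: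
  fixes A :: "'a set" and m l :: "'a list \<Rightarrow> real"
  defines "q \<equiv> \<lambda>u v. l u / m u * m (u @ v)"
  assumes m: "shift_process A m" and l: "shift_process A l"
    and ac: "\<forall>w\<in>lists A. m w = 0 \<longrightarrow> l w = 0"
  shows "rel_ent A l m (N + j) - rel_ent A l m N
      = (\<Sum>u\<in>wlists A N. \<Sum>v\<in>wlists A j. l (u @ v) * ln (l (u @ v) / q u v) - l (u @ v) + q u v)"
    and "\<And>u v. u \<in> lists A \<Longrightarrow> v \<in> lists A \<Longrightarrow> q u v = 0 \<Longrightarrow> l (u @ v) = 0"
    and "(\<Sum>u\<in>wlists A N. \<Sum>v\<in>wlists A j. q u v) = 1"
proof -
  interpret m: shift_process A m by fact
  interpret l: shift_process A l by fact
  show q0: "l (u @ v) = 0" if "u \<in> lists A" "v \<in> lists A" "q u v = 0" for u v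
  proof -
    have "l u = 0 \<or> m u = 0 \<or> m (u @ v) = 0" using that(3) by (auto simp: q_def)
    then show ?thesis
      using that ac[rule_format, of u] ac[rule_format, of "u @ v"] l.append_le[of u v] l.m_nonneg[of "u @ v"] by auto
  qed
  have sq: "(\<Sum>v\<in>wlists A j. q u v) = l u" if "u \<in> wlists A N" for u
    unfolding q_def sum_distrib_left[symmetric] m.sum_append_right[OF in_wlists_lists[OF that]]
    using ac in_wlists_lists[OF that] by auto
  then show s1: "(\<Sum>u\<in>wlists A N. \<Sum>v\<in>wlists A j. q u v) = 1"
    using l.sum_wlists[of N] by simp
  \<comment> \<open>Chain rule: \<open>q u v\<close> contains exactly the factor
    \<open>l u / m u\<close> whose logarithm is subtracted.\<close>
  have pt: "l (u @ v) * ln (l (u @ v) / m (u @ v)) - l (u @ v) * ln (l u / m u)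
      = l (u @ v) * ln (l (u @ v) / q u v)" if "u \<in> lists A" "v \<in> lists A" for u v
  proof (cases "l (u @ v) = 0")
    case False
    then have pos: "l (u @ v) > 0" "m (u @ v) > 0" "l u > 0" "m u > 0"
      using that ac[rule_format, of u] ac[rule_format, of "u @ v"] l.append_le[of u v] m.append_le[of u v]
        l.m_nonneg[of "u @ v"] m.m_nonneg[of "u @ v"] l.m_nonneg[of u] m.m_nonneg[of u]
      by (auto simp: less_le)
    then show ?thesis by (simp add: q_def ln_div ln_mult algebra_simps)
  qed simp
  have "rel_ent A l m (N + j) = (\<Sum>u\<in>wlists A N. \<Sum>v\<in>wlists A j. l (u @ v) * ln (l (u @ v) / m (u @ v)))"
    by (simp add: rel_ent_def sum_wlists_add)
  moreover have "rel_ent A l m N = (\<Sum>u\<in>wlists A N. \<Sum>v\<in>wlists A j. l (u @ v) * ln (l u / m u))"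
    unfolding rel_ent_def sum_distrib_right[symmetric]
    by (intro sum.cong refl) (simp add: l.sum_append_right in_wlists_lists)
  ultimately have "rel_ent A l m (N + j) - rel_ent A l m N
      = (\<Sum>u\<in>wlists A N. \<Sum>v\<in>wlists A j. l (u @ v) * ln (l (u @ v) / q u v))"
    by (simp add: sum_subtractf[symmetric] pt in_wlists_lists)
  \<comment> \<open>Both \<open>l (u @ v)\<close> and \<open>q u v\<close> have total mass 1, so
    inserting \<open>- l (u @ v) + q u v\<close> leaves the sum unchanged while each summand becomes
    nonnegative.\<close>
  moreover have "(\<Sum>u\<in>wlists A N. \<Sum>v\<in>wlists A j. l (u @ v)) = 1"
    using l.sum_wlists[of "N + j"] by (simp add: sum_wlists_add)
  ultimately show "rel_ent A l m (N + j) - rel_ent A l m N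
      = (\<Sum>u\<in>wlists A N. \<Sum>v\<in>wlists A j. l (u @ v) * ln (l (u @ v) / q u v) - l (u @ v) + q u v)"
    by (simp add: sum.distrib sum_subtractf s1)
qed

text \<open>\<open>F\<close> is arbitrary and \<open>j\<close> enters only through the entropy
  increment: if this is at most \<open>e * e\<close>, no event in the letters after position
  \<open>N\<close> is less likely under \<open>l\<close> than under the continuation by
  \<open>m\<close> by more than \<open>2 * e\<close>.\<close>

lemma rel_ent_event_bound:
  fixes A :: "'a set" and m l :: "'a list \<Rightarrow> real"
  assumes m: "shift_process A m" and l: "shift_process A l"
    and ac: "\<forall>w\<in>lists A. m w = 0 \<longrightarrow> l w = 0"
    and e: "e > 0" and F: "F \<subseteq> wlists A j"
  shows "(\<Sum>u\<in>wlists A N. \<Sum>v\<in>F. l u / m u * m (u @ v) - l (u @ v))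
      \<le> e + (rel_ent A l m (N + j) - rel_ent A l m N) / e"
proof -
  interpret m: shift_process A m by fact
  interpret l: shift_process A l by fact
  define q where "q u v = l u / m u * m (u @ v)" for u v
  define T where "T u v = l (u @ v) * ln (l (u @ v) / q u v) - l (u @ v) + q u v" for u v
  note inc = rel_ent_increment[OF m l ac, folded q_def T_def]
  have q0: "q u v \<ge> 0" for u v by (simp add: q_def m.m_nonneg l.m_nonneg)
  have T0: "T u v \<ge> 0" if "u \<in> wlists A N" "v \<in> wlists A j" for u v
    unfolding T_def using that inc(2)[of u v] q0 by (intro kl_nonneg) (auto simp: l.m_nonneg in_wlists_lists)
  have "(\<Sum>u\<in>wlists A N. \<Sum>v\<in>F. q u v - l (u @ v)) \<le> (\<Sum>u\<in>wlists A N. \<Sum>v\<in>F. e * q u v + T u v / e)"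
    using F e inc(2) q0 unfolding T_def
    by (intro sum_mono kl_pointwise) (auto simp: l.m_nonneg in_wlists_lists subset_iff)
  \<comment> \<open>Enlarging \<open>F\<close> to all words is allowed because \<open>q\<close> and
    \<open>T\<close> are nonnegative; then the total mass 1 and the increment formula apply.\<close>
  also have "\<dots> \<le> (\<Sum>u\<in>wlists A N. \<Sum>v\<in>wlists A j. e * q u v + T u v / e)"
    using F e q0 T0 by (intro sum_mono sum_mono2) (auto simp: finite_wlists m.finite_A)
  also have "\<dots> = e * (\<Sum>u\<in>wlists A N. \<Sum>v\<in>wlists A j. q u v) + (\<Sum>u\<in>wlists A N. \<Sum>v\<in>wlists A j. T u v) / e"
    by (simp add: sum.distrib sum_distrib_left sum_divide_distrib)
  finally show ?thesis
    unfolding inc(1) inc(3) by (simp only: q_def T_def mult_1_right)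
qed

lemma rel_ent_mono:
  assumes m: "shift_process A m" and l: "shift_process A l"
    and ac: "\<forall>w\<in>lists A. m w = 0 \<longrightarrow> l w = 0"
  shows "rel_ent A l m N \<le> rel_ent A l m (N + j)"
proof -
  interpret m: shift_process A m by fact
  interpret l: shift_process A l by fact
  note inc = rel_ent_increment[OF m l ac]
  have "0 \<le> rel_ent A l m (N + j) - rel_ent A l m N"
    unfolding inc(1) using inc(2)
    by (intro sum_nonneg kl_nonneg) (auto simp: l.m_nonneg m.m_nonneg in_wlists_lists)
  then show ?thesis by simp
qed

lemma rel_ent_nonneg:
  assumes m: "shift_process A m" and l: "shift_process A l"
    and ac: "\<forall>w\<in>lists A. m w = 0 \<longrightarrow> l w = 0"
  shows "0 \<le> rel_ent A l m n"
  using rel_ent_mono[OF m l ac, of 0 n] shift_process.m_Nil[OF m] shift_process.m_Nil[OF l]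
  by (simp add: rel_ent_def)

text \<open>A process \<open>l\<close> of bounded relative entropy has an \<open>L\<^sup>1\<close> density with respect to \<open>m\<close>. After
  a gap, the mixing of \<open>m\<close> spreads the mass of \<open>l - t m\<close>, where \<open>t = inf l / m\<close>, so that
  \<open>l \<ge> (t + c (1 - t)) m\<close>; hence \<open>t = 1\<close>.\<close>

proposition process_eqI:
  fixes A :: "'a set" and m l :: "'a list \<Rightarrow> real"
  assumes m: "shift_process A m" and l: "shift_process A l"
    and ac: "\<forall>w\<in>lists A. m w = 0 \<longrightarrow> l w = 0"
    and c: "c > 0"
    and low: "\<And>u v. u \<in> lists A \<Longrightarrow> v \<in> lists A \<Longrightarrow> c * m u * m v \<le> (\<Sum>x\<in>wlists A p. m (u @ x @ v))"
    and D: "\<And>n. rel_ent A l m n \<le> D"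
    and w: "w \<in> lists A"
  shows "l w = m w"
proof -
  interpret m: shift_process A m by fact
  interpret l: shift_process A l by fact
  define S where "S = {w \<in> lists A. m w > 0}"
  define t where "t = (INF w\<in>S. l w / m w)"
  have S: "[] \<in> S" by (auto simp: S_def m.m_Nil)
  have bdd: "bdd_below ((\<lambda>w. l w / m w) ` S)"
    by (rule bdd_belowI2[of _ 0]) (simp add: l.m_nonneg m.m_nonneg)
  have t_le: "t * m u \<le> l u" if "u \<in> lists A" for u
  proof (cases "m u > 0")
    case True
    then have "t \<le> l u / m u" unfolding t_def using that by (intro cINF_lower[OF bdd]) (auto simp: S_def)
    with True show ?thesis by (simp add: field_simps)
  next
    case False
    then have "m u = 0" using m.m_nonneg[of u] by simp
    then show ?thesis by (simp add: l.m_nonneg)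
  qed
  \<comment> \<open>\<open>N\<close> is chosen so that \<open>rel_ent\<close> at \<open>N\<close> is
    within \<open>d\<close> of its supremum.\<close>
  have Cauchy: "\<exists>N. \<forall>j. rel_ent A l m (N + j) - rel_ent A l m N \<le> d" if "d > 0" for d
  proof -
    have bd: "bdd_above (range (rel_ent A l m))" using D by (intro bdd_aboveI2[where M = D]) auto
    have "\<exists>N. (SUP n. rel_ent A l m n) - d < rel_ent A l m N"
      using less_cSUP_iff[OF _ bd, of "(SUP n. rel_ent A l m n) - d"] that by auto
    then obtain N where "(SUP n. rel_ent A l m n) - d < rel_ent A l m N" ..
    moreover have "rel_ent A l m n \<le> (SUP n. rel_ent A l m n)" for n
      by (rule cSUP_upper[OF _ bd]) simp
    ultimately show ?thesis by (metis diff_less_eq less_eq_real_def add.commute diff_le_eq order_trans)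
  qed
  have improve: "(t + c * (1 - t)) * m B \<le> l B" if B: "B \<in> lists A" for B
  proof (rule field_le_epsilon)
    fix e' :: real assume "e' > 0"
    define e where "e = e' / 2"
    have e: "e > 0" using \<open>e' > 0\<close> by (simp add: e_def)
    obtain N where N: "\<And>j. rel_ent A l m (N + j) - rel_ent A l m N \<le> e * e"
      using Cauchy[of "e * e"] e by auto
    \<comment> \<open>\<open>F\<close> is the event that \<open>B\<close> occurs after a gap of
      \<open>p\<close> letters. Summed over all \<open>u\<close>, its probability under
      \<open>l\<close> is \<open>l B\<close> by stationarity.\<close>
    define F where "F = (\<lambda>x. x @ B) ` wlists A p"
    have F: "F \<subseteq> wlists A (p + length B)"
      using B by (auto simp: F_def wlists_def)
    have sumF: "(\<Sum>v\<in>F. h v) = (\<Sum>x\<in>wlists A p. h (x @ B))" for h :: "'a list \<Rightarrow> real"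
      unfolding F_def by (subst sum.reindex) (auto simp: inj_on_def)
    define J where "J u = (\<Sum>x\<in>wlists A p. m (u @ x @ B))" for u
    have "(\<Sum>u\<in>wlists A N. \<Sum>v\<in>F. l u / m u * m (u @ v) - l (u @ v)) \<le> e + (e * e) / e"
      using rel_ent_event_bound[OF m l ac e F, of N] N[of "p + length B"] e
      by (smt (verit) divide_right_mono)
    then have ub: "(\<Sum>u\<in>wlists A N. l u / m u * J u) - (\<Sum>u\<in>wlists A N. \<Sum>x\<in>wlists A p. l (u @ x @ B)) \<le> e'"
      using e by (simp add: sumF sum_subtractf J_def sum_distrib_left e_def)
    have "(\<Sum>u\<in>wlists A N. \<Sum>x\<in>wlists A p. l (u @ x @ B)) = (\<Sum>u\<in>wlists A (N + p). l (u @ B))"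
      by (simp add: sum_wlists_add)
    then have lB: "(\<Sum>u\<in>wlists A N. \<Sum>x\<in>wlists A p. l (u @ x @ B)) = l B"
      using l.sum_append_left[OF B] by simp
    have "(\<Sum>u\<in>wlists A N. J u) = (\<Sum>u\<in>wlists A (N + p). m (u @ B))"
      by (simp add: sum_wlists_add J_def)
    then have JB: "(\<Sum>u\<in>wlists A N. J u) = m B" using m.sum_append_left[OF B] by simp
    \<comment> \<open>Split \<open>l u / m u\<close> as \<open>t + (l u / m u - t)\<close>. The
      first part contributes \<open>t * J u\<close>; the second is nonnegative, so the gap bound
      \<open>low\<close> applies to it.\<close>
    have pt: "t * J u + c * m B * (l u - t * m u) \<le> l u / m u * J u" if u: "u \<in> wlists A N" for u
    proof (cases "m u > 0")
      case True
      have "(l u / m u - t) * (c * m u * m B) \<le> (l u / m u - t) * J u"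
        using low[of u B] B u t_le[of u] True unfolding J_def
        by (intro mult_left_mono) (auto simp: in_wlists_lists field_simps)
      moreover have "(l u / m u - t) * (c * m u * m B) = c * m B * (l u - t * m u)"
        using True by (simp add: field_simps)
      ultimately show ?thesis
        using left_diff_distrib[of "l u / m u" t "J u"] by linarith
    next
      case False
      then have mu: "m u = 0" using m.m_nonneg[of u] by simp
      have "m (u @ x @ B) = 0" if "x \<in> wlists A p" for x
        using m.append_le[of u "x @ B"] u that B mu m.m_nonneg[of "u @ x @ B"] by (auto simp: in_wlists_lists)
      then have "J u = 0" by (simp add: J_def)
      then show ?thesis using mu ac[rule_format, of u] u by (simp add: in_wlists_lists)
    qed
    have "(t + c * (1 - t)) * m B = t * (\<Sum>u\<in>wlists A N. J u)
        + c * m B * ((\<Sum>u\<in>wlists A N. l u) - t * (\<Sum>u\<in>wlists A N. m u))"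
      by (simp add: JB l.sum_wlists m.sum_wlists algebra_simps)
    also have "\<dots> = (\<Sum>u\<in>wlists A N. t * J u + c * m B * (l u - t * m u))"
      by (simp add: sum.distrib sum_distrib_left sum_subtractf right_diff_distrib)
    also have "\<dots> \<le> (\<Sum>u\<in>wlists A N. l u / m u * J u)" by (intro sum_mono pt)
    also have "\<dots> \<le> l B + e'" using ub lB by simp
    finally show "(t + c * (1 - t)) * m B \<le> l B + e'" .
  qed
  \<comment> \<open>The improved factor is a lower bound for every ratio \<open>l w / m w\<close>,
    so it cannot exceed their infimum \<open>t\<close>.\<close>
  have "t + c * (1 - t) \<le> t"
    unfolding t_def
    by (rule cINF_greatest, use S in blast, fold t_def)
       (use improve in \<open>auto simp: S_def field_simps\<close>)
  then have "t \<ge> 1" using c by (simp add: mult_le_0_iff)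
  then have ge: "m u \<le> l u" if "u \<in> lists A" for u
    using t_le[OF that] m.m_nonneg[of u] mult_right_mono[of 1 t "m u"] by simp
  have "l w - m w = 0"
  proof (rule sum_nonneg_0[of "wlists A (length w)" "\<lambda>w. l w - m w"])
    show "(\<Sum>w\<in>wlists A (length w). l w - m w) = 0"
      by (simp add: sum_subtractf l.sum_wlists m.sum_wlists)
  qed (use w ge in \<open>auto simp: finite_wlists m.finite_A in_wlists_lists lists_in_wlists\<close>)
  then show ?thesis by simp
qed

section \<open>Mixing\<close>

lemma sum_wlists_pair:
  "(\<Sum>z\<in>wlists (A \<times> B) n. h (map fst z) (map snd z)) = (\<Sum>u\<in>wlists A n. \<Sum>v\<in>wlists B n. h u v)"
proof -
  have "(\<Sum>u\<in>wlists A n. \<Sum>v\<in>wlists B n. h u v) = (\<Sum>(u, v)\<in>wlists A n \<times> wlists B n. h u v)"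
    by (rule sum.cartesian_product)
  also have "\<dots> = (\<Sum>z\<in>wlists (A \<times> B) n. h (map fst z) (map snd z))"
  proof (rule sum.reindex_bij_witness[where i = "\<lambda>z. (map fst z, map snd z)" and j = "\<lambda>(u, v). zip u v"])
    show "(case a of (u, v) \<Rightarrow> zip u v) \<in> wlists (A \<times> B) n" if "a \<in> wlists A n \<times> wlists B n" for a
      using that by (auto simp: wlists_def dest: set_zip_leftD set_zip_rightD)
  qed (auto simp: wlists_def zip_map_fst_snd)
  finally show ?thesis by simp
qed

lemma lists_Times_iff: "z \<in> lists (A \<times> B) \<longleftrightarrow> map fst z \<in> lists A \<and> map snd z \<in> lists B"
  by (induction z) auto

lemma shift_process_pair:
  assumes "shift_process A m"
  shows "shift_process (A \<times> A) (\<lambda>z. m (map fst z) * m (map snd z))"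
proof -
  interpret shift_process A m by fact
  show ?thesis
  proof
    fix z assume "z \<in> lists (A \<times> A)"
    then have z: "map fst z \<in> lists A" "map snd z \<in> lists A" by (simp_all add: lists_Times_iff)
    show "(\<Sum>a\<in>A \<times> A. m (map fst (z @ [a])) * m (map snd (z @ [a]))) = m (map fst z) * m (map snd z)"
      using m_snoc[OF z(1)] m_snoc[OF z(2)]
      by (simp add: sum.cartesian_product' sum_product[symmetric])
    show "(\<Sum>a\<in>A \<times> A. m (map fst (a # z)) * m (map snd (a # z))) = m (map fst z) * m (map snd z)"
      using m_Cons[OF z(1)] m_Cons[OF z(2)]
      by (simp add: sum.cartesian_product' sum_product[symmetric])
  qed (auto simp: finite_A m_Nil m_nonneg)
qed

lemma tendsto_of_subsequences:
  fixes f :: "nat \<Rightarrow> 'a::metric_space"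
  assumes "\<And>r :: nat \<Rightarrow> nat. strict_mono r \<Longrightarrow> \<exists>k :: nat \<Rightarrow> nat. strict_mono k \<and> (\<lambda>n. f (r (k n))) \<longlonglongrightarrow> l"
  shows "f \<longlonglongrightarrow> l"
proof (rule ccontr)
  assume "\<not> f \<longlonglongrightarrow> l"
  then obtain e where e: "e > 0" and "\<forall>N. \<exists>n\<ge>N. \<not> dist (f n) l < e"
    unfolding lim_sequentially by auto
  then have inf: "infinite {n. \<not> dist (f n) l < e}"
    unfolding infinite_nat_iff_unbounded_le by auto
  obtain k :: "nat \<Rightarrow> nat" where k: "strict_mono k" "(\<lambda>n. f (enumerate {n. \<not> dist (f n) l < e} (k n))) \<longlonglongrightarrow> l"
    using assms[OF strict_mono_enumerate[OF inf]] by auto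
  then obtain n where "dist (f (enumerate {n. \<not> dist (f n) l < e} (k n))) l < e"
    using e unfolding lim_sequentially by blast
  then show False using enumerate_in_set[OF inf, of "k n"] by auto
qed

text \<open>The index \<open>n\<close> is the gap, not the shift: the second word starts at position
  \<open>length u + n\<close>.\<close>

definition joint :: "'a set \<Rightarrow> ('a list \<Rightarrow> real) \<Rightarrow> nat \<Rightarrow> 'a list \<Rightarrow> 'a list \<Rightarrow> real" where
  "joint A m n u v = (\<Sum>w\<in>wlists A n. m (u @ w @ v))"

text \<open>The upper bound concerns adjacent words, the lower bound only words across a gap of
  \<open>p\<close> letters, because \<open>u @ v\<close> itself may have probability 0.\<close>

locale mixing_process = shift_process +
  fixes c K :: real and p :: nat
  assumes c_pos: "c > 0" and K_pos: "K > 0"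
    and joint_ge: "\<And>u v. u \<in> lists A \<Longrightarrow> v \<in> lists A \<Longrightarrow> c * m u * m v \<le> joint A m p u v"
    and append_le_mult: "\<And>u v. u \<in> lists A \<Longrightarrow> v \<in> lists A \<Longrightarrow> m (u @ v) \<le> K * m u * m v"
begin

lemma joint_nonneg: "0 \<le> joint A m n u v"
  unfolding joint_def by (intro sum_nonneg m_nonneg)

text \<open>The constant does not depend on the gap \<open>n\<close>; this uniformity is what
  dominates the limit points of the pair laws.\<close>

lemma joint_le: 
  assumes "u \<in> lists A" "v \<in> lists A"
  shows "joint A m n u v \<le> K * m u * m v"
proof -
  have "joint A m n u v \<le> (\<Sum>w\<in>wlists A n. K * m (u @ w) * m v)"
    unfolding joint_def using append_le_mult[of "u @ _" v] assms
    by (intro sum_mono) (auto simp: in_wlists_lists)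
  also have "\<dots> = K * m u * m v"
    using sum_append_right[OF assms(1), of n] by (simp add: sum_distrib_left[symmetric] sum_distrib_right[symmetric])
  finally show ?thesis .
qed

lemma eqI:
  assumes "shift_process A l" and ac: "\<forall>w\<in>lists A. m w = 0 \<longrightarrow> l w = 0"
    and "\<And>n. rel_ent A l m n \<le> D" and "w \<in> lists A"
  shows "l w = m w"
  by (rule process_eqI[OF shift_process_axioms assms(1) ac c_pos joint_ge[unfolded joint_def] assms(3,4)])

lemma eqI_dominated:
  assumes l: "shift_process A l" and dom: "\<And>w. w \<in> lists A \<Longrightarrow> l w \<le> D * m w" and w: "w \<in> lists A"
  shows "l w = m w"
proof (rule eqI[OF l _ _ w])
  interpret l: shift_process A l by fact
  show ac: "\<forall>w\<in>lists A. m w = 0 \<longrightarrow> l w = 0"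
    using dom l.m_nonneg by (metis antisym mult_zero_right)
  have D: "D > 0" using dom[of "[]"] by (simp add: m_Nil l.m_Nil)
  fix n
  have "rel_ent A l m n \<le> (\<Sum>w\<in>wlists A n. l w * ln D)"
    unfolding rel_ent_def
  proof (intro sum_mono)
    fix w assume "w \<in> wlists A n"
    then have w: "w \<in> lists A" by (rule in_wlists_lists)
    show "l w * ln (l w / m w) \<le> l w * ln D"
    proof (cases "l w = 0")
      case False
      then have "l w > 0" "m w > 0" using w ac m_nonneg[of w] l.m_nonneg[of w] by (auto simp: less_le)
      then show ?thesis using dom[OF w] D by (intro mult_left_mono) (auto simp: field_simps)
    qed simp
  qed
  also have "\<dots> = ln D" using l.sum_wlists[of n] by (simp add: sum_distrib_right[symmetric])
  finally show "rel_ent A l m n \<le> ln D" .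
qed

text \<open>Two independent copies: gap words over pairs are pairs of gap words, so
  \<open>joint\<close> of the product is the product of two \<open>joint\<close> terms, and both
  constants are squared.\<close>

lemma mixing_process_pair:
  "mixing_process (A \<times> A) (\<lambda>z. m (map fst z) * m (map snd z)) (c\<^sup>2) (K\<^sup>2) p"
proof -
  interpret q: shift_process "A \<times> A" "\<lambda>z. m (map fst z) * m (map snd z)"
    by (rule shift_process_pair[OF shift_process_axioms])
  show ?thesis
  proof
    fix y z assume "y \<in> lists (A \<times> A)" "z \<in> lists (A \<times> A)"
    then have yz: "map fst y \<in> lists A" "map snd y \<in> lists A" "map fst z \<in> lists A" "map snd z \<in> lists A"
      by (simp_all add: lists_Times_iff)
    have "(c * m (map fst y) * m (map fst z)) * (c * m (map snd y) * m (map snd z))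
        \<le> joint A m p (map fst y) (map fst z) * joint A m p (map snd y) (map snd z)"
      using joint_ge[of "map fst y" "map fst z"] joint_ge[of "map snd y" "map snd z"] yz c_pos
      by (intro mult_mono) (auto simp: joint_nonneg m_nonneg)
    also have "\<dots> = joint (A \<times> A) (\<lambda>z. m (map fst z) * m (map snd z)) p y z"
      by (simp add: joint_def sum_product sum_wlists_pair[where
        h = "\<lambda>u v. m (map fst y @ u @ map fst z) * m (map snd y @ v @ map snd z)", symmetric])
    finally show "c\<^sup>2 * (m (map fst y) * m (map snd y)) * (m (map fst z) * m (map snd z))
        \<le> joint (A \<times> A) (\<lambda>z. m (map fst z) * m (map snd z)) p y z"
      by (simp add: power2_eq_square mult_ac)
    have "m (map fst y @ map fst z) * m (map snd y @ map snd z)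
        \<le> (K * m (map fst y) * m (map fst z)) * (K * m (map snd y) * m (map snd z))"
      using yz K_pos by (intro mult_mono append_le_mult) (auto simp: m_nonneg)
    then show "m (map fst (y @ z)) * m (map snd (y @ z))
        \<le> K\<^sup>2 * (m (map fst y) * m (map snd y)) * (m (map fst z) * m (map snd z))"
      by (simp add: power2_eq_square mult_ac)
  qed (use c_pos K_pos in auto)
qed

text \<open>The law of the pairs formed by a point and its \<open>n\<close>-th shift: two blocks of
  length \<open>length z\<close> leave a gap of \<open>n - length z\<close>. For longer
  \<open>z\<close> the blocks overlap; the value 0 keeps nonnegativity and domination and is
  invisible in the limit.\<close>

definition pair_joint :: "nat \<Rightarrow> ('a \<times> 'a) list \<Rightarrow> real" where
  "pair_joint n z = (if length z \<le> n then joint A m (n - length z) (map fst z) (map snd z) else 0)"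

lemma pair_joint_nonneg: "0 \<le> pair_joint n z"
  by (simp add: pair_joint_def joint_nonneg)

lemma pair_joint_le:
  assumes "z \<in> lists (A \<times> A)"
  shows "pair_joint n z \<le> K * (m (map fst z) * m (map snd z))"
  using assms joint_le[of "map fst z" "map snd z"] K_pos
  by (auto simp: pair_joint_def m_nonneg lists_Times_iff mult_ac)

text \<open>The new first coordinate consumes the first letter of the gap; the new second coordinate
  stands at the far end and is summed away by consistency. This requires a nonempty gap.\<close>

lemma pair_joint_snoc:
  assumes z: "z \<in> lists (A \<times> A)" and n: "length z < n"
  shows "(\<Sum>a\<in>A \<times> A. pair_joint n (z @ [a])) = pair_joint n z"
proof -
  define k where "k = n - Suc (length z)"
  have k: "n - length z = Suc 0 + k" using n by (simp add: k_def)
  have "(\<Sum>a\<in>A \<times> A. pair_joint n (z @ [a]))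
      = (\<Sum>a\<in>A. \<Sum>b\<in>A. \<Sum>w\<in>wlists A k. m (map fst z @ a # w @ map snd z @ [b]))"
    using n by (simp add: pair_joint_def joint_def k_def sum.cartesian_product')
  also have "\<dots> = (\<Sum>a\<in>A. \<Sum>w\<in>wlists A k. \<Sum>b\<in>A. m ((map fst z @ a # w @ map snd z) @ [b]))"
    by (subst sum.swap) simp
  also have "\<dots> = (\<Sum>a\<in>A. \<Sum>w\<in>wlists A k. m (map fst z @ a # w @ map snd z))"
    using z by (intro sum.cong refl m_snoc) (auto simp: lists_Times_iff in_wlists_lists wlists_def)
  also have "\<dots> = pair_joint n z"
    using n by (simp only: pair_joint_def joint_def k sum_wlists_add sum_wlists_1) simp
  finally show ?thesis .
qed

text \<open>Mirror image: the new second coordinate consumes the last letter of the gap, and the new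
  first coordinate is summed away by stationarity.\<close>

lemma pair_joint_Cons:
  assumes z: "z \<in> lists (A \<times> A)" and n: "length z < n"
  shows "(\<Sum>a\<in>A \<times> A. pair_joint n (a # z)) = pair_joint n z"
proof -
  define k where "k = n - Suc (length z)"
  have k: "n - length z = k + Suc 0" using n by (simp add: k_def)
  have "(\<Sum>a\<in>A \<times> A. pair_joint n (a # z))
      = (\<Sum>a\<in>A. \<Sum>b\<in>A. \<Sum>w\<in>wlists A k. m (a # map fst z @ w @ b # map snd z))"
    using n by (simp add: pair_joint_def joint_def k_def sum.cartesian_product')
  also have "\<dots> = (\<Sum>b\<in>A. \<Sum>w\<in>wlists A k. \<Sum>a\<in>A. m (a # map fst z @ w @ b # map snd z))"
    by (subst sum.swap, intro sum.cong refl, rule sum.swap)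
  also have "\<dots> = (\<Sum>b\<in>A. \<Sum>w\<in>wlists A k. m (map fst z @ w @ b # map snd z))"
    using z by (intro sum.cong refl m_Cons) (auto simp: lists_Times_iff in_wlists_lists wlists_def)
  also have "\<dots> = (\<Sum>w\<in>wlists A k. \<Sum>b\<in>A. m (map fst z @ w @ b # map snd z))"
    by (rule sum.swap)
  also have "\<dots> = pair_joint n z"
    using n by (simp only: pair_joint_def joint_def k sum_wlists_add sum_wlists_1) simp
  finally show ?thesis .
qed

text \<open>Every limit point of the laws of the pairs \<open>(x, \<sigma>\<^sup>n x)\<close> is a shift-invariant process
  dominated by a multiple of \<open>m \<times> m\<close>, hence equal to \<open>m \<times> m\<close>.\<close>

lemma pair_joint_tendsto:
  assumes z: "z \<in> lists (A \<times> A)"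
  shows "(\<lambda>n. pair_joint n z) \<longlonglongrightarrow> m (map fst z) * m (map snd z)"
proof (rule tendsto_of_subsequences)
  fix r :: "nat \<Rightarrow> nat" assume r: "strict_mono r"
  have bound: "norm (pair_joint (r n) y) \<le> K" if "y \<in> lists (A \<times> A)" for n y
  proof -
    have "m (map fst y) * m (map snd y) \<le> 1 * 1"
      using that by (intro mult_mono le_one) (auto simp: lists_Times_iff m_nonneg)
    then have "K * (m (map fst y) * m (map snd y)) \<le> K" using K_pos by simp
    then show ?thesis using pair_joint_le[OF that, of "r n"] pair_joint_nonneg[of "r n" y] by simp
  qed
  have "countable (lists (A \<times> A))" using finite_A by (simp add: countable_finite)
  \<comment> \<open>Diagonal argument: there are countably many words, and for each the values are
    bounded by \<open>K\<close>.\<close>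
  then obtain k :: "nat \<Rightarrow> nat" where k: "strict_mono k"
    and lim: "\<And>y. y \<in> lists (A \<times> A) \<Longrightarrow> \<exists>l. (\<lambda>n. pair_joint (r (k n)) y) \<longlonglongrightarrow> l"
    using function_convergent_subsequence[of "lists (A \<times> A)" "\<lambda>n. pair_joint (r n)" K] bound by metis
  \<comment> \<open>The default 0 is there because \<open>shift_process\<close> asks for
    nonnegativity on all lists.\<close>
  define L where "L y = (if y \<in> lists (A \<times> A) then lim (\<lambda>n. pair_joint (r (k n)) y) else 0)" for y
  have L: "(\<lambda>n. pair_joint (r (k n)) y) \<longlonglongrightarrow> L y" if "y \<in> lists (A \<times> A)" for y
    using lim[OF that] that by (auto simp: L_def limI)
  have large: "eventually (\<lambda>n. j < r (k n)) sequentially" for j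
  proof -
    have "filterlim (\<lambda>n. r (k n)) sequentially sequentially"
      using filterlim_subseq[OF strict_mono_o[OF r k]] by (simp add: o_def)
    then have "eventually (\<lambda>n. Suc j \<le> r (k n)) sequentially"
      unfolding filterlim_at_top by blast
    then show ?thesis by (rule eventually_mono) simp
  qed
  interpret q: mixing_process "A \<times> A" "\<lambda>z. m (map fst z) * m (map snd z)" "c\<^sup>2" "K\<^sup>2" p
    by (rule mixing_process_pair)
  have "shift_process (A \<times> A) L"
  proof
    show "finite (A \<times> A)" by (simp add: finite_A)
    have "pair_joint n [] = 1" for n by (simp add: pair_joint_def joint_def sum_wlists)
    then show "L [] = 1" using L[of "[]"] by (simp add: LIMSEQ_const_iff)
    show "0 \<le> L y" for y
    proof (cases "y \<in> lists (A \<times> A)")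
      case True
      show ?thesis by (rule LIMSEQ_le_const[OF L[OF True]]) (simp add: pair_joint_nonneg)
    qed (simp add: L_def)
    fix y assume y: "y \<in> lists (A \<times> A)"
    have "(\<lambda>n. \<Sum>a\<in>A \<times> A. pair_joint (r (k n)) (y @ [a])) \<longlonglongrightarrow> (\<Sum>a\<in>A \<times> A. L (y @ [a]))"
      using y by (intro tendsto_sum L) auto
    moreover have "eventually (\<lambda>n. (\<Sum>a\<in>A \<times> A. pair_joint (r (k n)) (y @ [a])) = pair_joint (r (k n)) y) sequentially"
      using large[of "length y"] by eventually_elim (rule pair_joint_snoc[OF y])
    ultimately have "(\<lambda>n. pair_joint (r (k n)) y) \<longlonglongrightarrow> (\<Sum>a\<in>A \<times> A. L (y @ [a]))"
      by (rule Lim_transform_eventually)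
    then show "(\<Sum>a\<in>A \<times> A. L (y @ [a])) = L y" using L[OF y] LIMSEQ_unique by blast
    have "(\<lambda>n. \<Sum>a\<in>A \<times> A. pair_joint (r (k n)) (a # y)) \<longlonglongrightarrow> (\<Sum>a\<in>A \<times> A. L (a # y))"
      using y by (intro tendsto_sum L) auto
    moreover have "eventually (\<lambda>n. (\<Sum>a\<in>A \<times> A. pair_joint (r (k n)) (a # y)) = pair_joint (r (k n)) y) sequentially"
      using large[of "length y"] by eventually_elim (rule pair_joint_Cons[OF y])
    ultimately have "(\<lambda>n. pair_joint (r (k n)) y) \<longlonglongrightarrow> (\<Sum>a\<in>A \<times> A. L (a # y))"
      by (rule Lim_transform_eventually)
    then show "(\<Sum>a\<in>A \<times> A. L (a # y)) = L y" using L[OF y] LIMSEQ_unique by blast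
  qed
  moreover have "L y \<le> K * (m (map fst y) * m (map snd y))" if "y \<in> lists (A \<times> A)" for y
    by (rule LIMSEQ_le_const2[OF L[OF that]]) (simp add: pair_joint_le[OF that])
  ultimately have "L z = m (map fst z) * m (map snd z)"
    using z by (rule q.eqI_dominated)
  then show "\<exists>k :: nat \<Rightarrow> nat. strict_mono k \<and> (\<lambda>n. pair_joint (r (k n)) z) \<longlonglongrightarrow> m (map fst z) * m (map snd z)"
    using k L[OF z] by auto
qed

lemma joint_tendsto_same_length:
  assumes u: "u \<in> lists A" and v: "v \<in> lists A" and len: "length u = length v"
  shows "(\<lambda>n. joint A m n u v) \<longlonglongrightarrow> m u * m v"
proof -
  have "zip u v \<in> lists (A \<times> A)" using assms by (simp add: lists_Times_iff)
  from LIMSEQ_ignore_initial_segment[OF pair_joint_tendsto[OF this], of "length v"] 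
  show ?thesis using len by (simp add: pair_joint_def)
qed

text \<open>Pair words need blocks of equal length. So \<open>length v\<close> letters of the gap
  extend \<open>u\<close> to the right, \<open>length u\<close> letters extend \<open>v\<close> to
  the left, and the added letters are summed away.\<close>

lemma joint_tendsto:
  assumes u: "u \<in> lists A" and v: "v \<in> lists A"
  shows "(\<lambda>n. joint A m n u v) \<longlonglongrightarrow> m u * m v"
proof (rule LIMSEQ_offset[of _ "length v + length u"])
  have "joint A m (n + (length v + length u)) u v
      = (\<Sum>a\<in>wlists A (length v). \<Sum>b\<in>wlists A (length u). joint A m n (u @ a) (b @ v))" for n
  proof -
    have "n + (length v + length u) = length v + (n + length u)" by simp
    have "joint A m (n + (length v + length u)) u v
        = (\<Sum>a\<in>wlists A (length v). \<Sum>w\<in>wlists A n. \<Sum>b\<in>wlists A (length u). m ((u @ a) @ w @ (b @ v)))"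
      unfolding joint_def \<open>n + (length v + length u) = length v + (n + length u)\<close> sum_wlists_add append_assoc ..
    also have "\<dots> = (\<Sum>a\<in>wlists A (length v). \<Sum>b\<in>wlists A (length u). joint A m n (u @ a) (b @ v))"
      unfolding joint_def by (intro sum.cong refl sum.swap)
    finally show ?thesis .
  qed
  moreover have "(\<lambda>n. \<Sum>a\<in>wlists A (length v). \<Sum>b\<in>wlists A (length u). joint A m n (u @ a) (b @ v))
      \<longlonglongrightarrow> (\<Sum>a\<in>wlists A (length v). \<Sum>b\<in>wlists A (length u). m (u @ a) * m (b @ v))"
    using u v by (intro tendsto_sum joint_tendsto_same_length) (auto simp: in_wlists_lists wlists_length)
  moreover have "(\<Sum>a\<in>wlists A (length v). \<Sum>b\<in>wlists A (length u). m (u @ a) * m (b @ v)) = m u * m v"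
    by (simp add: sum_product[symmetric] sum_append_right[OF u] sum_append_left[OF v])
  ultimately show "(\<lambda>n. joint A m (n + (length v + length u)) u v) \<longlonglongrightarrow> m u * m v" by simp
qed

end

section \<open>Entropy and cross entropy\<close>

text \<open>The limit is taken in \<open>ereal\<close> because the infimum may be minus infinity,
  which is not excluded for the cross terms below.\<close>

lemma fekete:
  fixes a :: "nat \<Rightarrow> real"
  assumes sub: "\<And>i j. i \<ge> 1 \<Longrightarrow> j \<ge> 1 \<Longrightarrow> a (i + j) \<le> a i + a j"
  shows "(\<lambda>n. ereal (a n / real n)) \<longlonglongrightarrow> (INF n\<in>{1..}. ereal (a n / real n))"
proof (rule order_tendstoI)
  fix x assume x: "x < (INF n\<in>{1..}. ereal (a n / real n))"
  show "eventually (\<lambda>n. x < ereal (a n / real n)) sequentially"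
    using eventually_ge_at_top[of 1]
    by eventually_elim (rule less_le_trans[OF x INF_lower], simp)
next
  fix x assume "(INF n\<in>{1..}. ereal (a n / real n)) < x"
  then obtain m where m: "m \<ge> 1" "ereal (a m / real m) < x" by (auto simp: INF_less_iff)
  obtain r where r: "a m / real m < r" "ereal r < x"
    using ereal_dense2[OF m(2)] by auto
  define M where "M = (\<Sum>s=1..m. \<bar>a s\<bar>)"
  have mult: "a (q * m + s) \<le> q * a m + M" if "s \<in> {1..m}" for q s
  proof (induction q)
    case 0
    have "\<bar>a s\<bar> \<le> M" unfolding M_def using that by (intro member_le_sum) auto
    then show ?case by simp
  next
    case (Suc q)
    have "a (m + (q * m + s)) \<le> a m + a (q * m + s)" using m that by (intro sub) auto
    then show ?case using Suc by (simp add: algebra_simps)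
  qed
  have bound: "a n / n \<le> a m / m + (M + \<bar>a m\<bar>) / n" if n: "n \<ge> 1" for n
  proof -
    \<comment> \<open>The remainder \<open>s\<close> runs through \<open>1..m\<close> and not
      \<open>0..m-1\<close>, since nothing is assumed about \<open>a 0\<close>.\<close>
    define q s where "q = (n - 1) div m" and "s = (n - 1) mod m + 1"
    have s: "s \<in> {1..m}" using m by (simp add: s_def Suc_le_eq)
    have nqs: "n = q * m + s" using n by (simp add: q_def s_def)
    then have "real n = q * real m + s" by simp
    then have "real q * a m = n * (a m / m) - (s / m) * a m"
      using m by (simp add: field_simps)
    moreover have "\<bar>(s / m) * a m\<bar> \<le> 1 * \<bar>a m\<bar>"
      unfolding abs_mult using s m by (intro mult_right_mono) auto
    then have "- ((s / m) * a m) \<le> \<bar>a m\<bar>" by linarith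
    ultimately have "a n \<le> n * (a m / m) + (M + \<bar>a m\<bar>)"
      using mult[OF s, of q, folded nqs] by linarith
    then have "a n / n \<le> (n * (a m / m) + (M + \<bar>a m\<bar>)) / n" by (intro divide_right_mono) auto
    then show ?thesis using n by (simp add: add_divide_distrib)
  qed
  have "(\<lambda>n. a m / m + (M + \<bar>a m\<bar>) / real n) \<longlonglongrightarrow> a m / m + 0"
    by (intro tendsto_add tendsto_const lim_const_over_n)
  then have "eventually (\<lambda>n. a m / m + (M + \<bar>a m\<bar>) / real n < r) sequentially"
    using r(1) by (intro order_tendstoD(2)) auto
  then show "eventually (\<lambda>n. ereal (a n / real n) < x) sequentially"
    using eventually_ge_at_top[of 1]
  proof eventually_elim
    case (elim n)
    then have "ereal (a n / n) < ereal r" using bound[of n] by simp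
    then show ?case using r(2) by (rule less_trans)
  qed
qed

definition ent :: "'a set \<Rightarrow> ('a list \<Rightarrow> real) \<Rightarrow> nat \<Rightarrow> real" where
  "ent A m n = - (\<Sum>w\<in>wlists A n. m w * ln (m w))"

text \<open>Minus the usual cross entropy. With this sign it is the analogue of the integral of a
  log potential, and free energy corresponds to entropy plus \<open>cross\<close>.\<close>

definition cross :: "'a set \<Rightarrow> ('a list \<Rightarrow> real) \<Rightarrow> ('a list \<Rightarrow> real) \<Rightarrow> nat \<Rightarrow> real" where
  "cross A l m n = (\<Sum>w\<in>wlists A n. l w * ln (m w))"

lemma rel_ent_eq:
  assumes "\<And>w. 0 \<le> l w" "\<And>w. 0 \<le> m w" and ac: "\<forall>w\<in>lists A. m w = 0 \<longrightarrow> l w = 0"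
  shows "rel_ent A l m n = - ent A l n - cross A l m n"
proof -
  have "l w * ln (l w / m w) = l w * ln (l w) - l w * ln (m w)" if "w \<in> wlists A n" for w
  proof (cases "l w = 0")
    case False
    then have "l w > 0" "m w > 0" 
      using assms(1,2)[of w] ac in_wlists_lists[OF that] by (auto simp: less_le)
    then show ?thesis by (simp add: ln_div right_diff_distrib)
  qed simp
  then show ?thesis by (simp add: rel_ent_def ent_def cross_def sum_subtractf)
qed

context shift_process
begin

text \<open>An observable that is additive in the two blocks sees only the marginals: consistency
  handles the first block, stationarity the second.\<close>

lemma sum_append_split:
  "(\<Sum>u\<in>wlists A i. \<Sum>v\<in>wlists A j. m (u @ v) * (x u + y v))
    = (\<Sum>u\<in>wlists A i. m u * x u) + (\<Sum>v\<in>wlists A j. m v * y v)"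
proof -
  have "(\<Sum>u\<in>wlists A i. \<Sum>v\<in>wlists A j. m (u @ v) * x u) = (\<Sum>u\<in>wlists A i. m u * x u)"
    by (intro sum.cong refl) (simp add: sum_distrib_right[symmetric] sum_append_right in_wlists_lists)
  moreover have "(\<Sum>u\<in>wlists A i. \<Sum>v\<in>wlists A j. m (u @ v) * y v) = (\<Sum>v\<in>wlists A j. m v * y v)"
    by (subst sum.swap, intro sum.cong refl)
      (simp add: sum_distrib_right[symmetric] sum_append_left in_wlists_lists)
  ultimately show ?thesis by (simp add: distrib_left sum.distrib)
qed

lemma ent_nonneg: "0 \<le> ent A m n"
proof -
  have "m w * ln (m w) \<le> 0" if "w \<in> wlists A n" for w
    using m_nonneg[of w] le_one[OF in_wlists_lists[OF that]]
    by (cases "m w = 0") (auto simp: mult_nonneg_nonpos)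
  then show ?thesis unfolding ent_def by (simp add: sum_nonpos)
qed

text \<open>Nonnegativity of the mutual information between the first \<open>i\<close> and the last
  \<open>j\<close> letters.\<close>

lemma ent_add_le: "ent A m (i + j) \<le> ent A m i + ent A m j"
proof -
  have pt: "m (u @ v) * (ln (m u) + ln (m v)) + m (u @ v) - m u * m v \<le> m (u @ v) * ln (m (u @ v))"
    if "u \<in> wlists A i" "v \<in> wlists A j" for u v
  proof (cases "m (u @ v) = 0")
    case False
    have "m (u @ v) \<le> m v"
      using member_le_sum[of u "wlists A i" "\<lambda>u. m (u @ v)"] that
      by (simp add: sum_append_left m_nonneg finite_wlists finite_A in_wlists_lists)
    moreover have "m (u @ v) \<le> m u" using that by (intro append_le) (auto simp: in_wlists_lists)
    ultimately have pos: "m (u @ v) > 0" "m u > 0" "m v > 0"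
      using False m_nonneg[of "u @ v"] by linarith+
    then show ?thesis
      using kl_nonneg[of "m (u @ v)" "m u * m v"] by (simp add: ln_div ln_mult algebra_simps)
  qed (simp add: m_nonneg)
  have "(\<Sum>u\<in>wlists A i. \<Sum>v\<in>wlists A j. m u * m v) = 1"
    by (simp add: sum_product[symmetric] sum_wlists)
  moreover have "(\<Sum>u\<in>wlists A i. \<Sum>v\<in>wlists A j. m (u @ v)) = 1"
    using sum_wlists[of "i + j"] by (simp add: sum_wlists_add)
  ultimately have "(\<Sum>u\<in>wlists A i. \<Sum>v\<in>wlists A j. m (u @ v) * (ln (m u) + ln (m v)))
      = (\<Sum>u\<in>wlists A i. \<Sum>v\<in>wlists A j. m (u @ v) * (ln (m u) + ln (m v)) + m (u @ v) - m u * m v)"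
    by (simp add: sum.distrib sum_subtractf)
  also have "\<dots> \<le> (\<Sum>u\<in>wlists A i. \<Sum>v\<in>wlists A j. m (u @ v) * ln (m (u @ v)))"
    by (intro sum_mono pt)
  finally show ?thesis
    unfolding ent_def sum_wlists_add sum_append_split by simp
qed

definition ent_rate :: real where
  "ent_rate = lim (\<lambda>n. ent A m n / real n)"

lemma ent_tendsto: "(\<lambda>n. ent A m n / real n) \<longlonglongrightarrow> ent_rate"
  and ent_rate_le: "n \<ge> 1 \<Longrightarrow> ent_rate \<le> ent A m n / real n"
proof -
  define h where "h = (INF n\<in>{1..}. ereal (ent A m n / real n))"
  have "0 \<le> h" unfolding h_def by (intro INF_greatest) (simp add: ent_nonneg)
  moreover have "h \<le> ereal (ent A m 1 / real 1)" unfolding h_def by (intro INF_lower) simp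
  ultimately obtain h' where h': "h = ereal h'" by (cases h) auto
  have "(\<lambda>n. ereal (ent A m n / real n)) \<longlonglongrightarrow> ereal h'"
    unfolding h'[symmetric] h_def by (rule fekete) (rule ent_add_le)
  then have lim: "(\<lambda>n. ent A m n / real n) \<longlonglongrightarrow> h'" by simp
  then have eq: "ent_rate = h'" by (simp add: ent_rate_def limI)
  show "(\<lambda>n. ent A m n / real n) \<longlonglongrightarrow> ent_rate" using lim eq by simp
  show "ent_rate \<le> ent A m n / real n" if "n \<ge> 1"
  proof -
    have "h \<le> ereal (ent A m n / real n)" unfolding h_def using that by (intro INF_lower) simp
    then show ?thesis by (simp add: eq h')
  qed
qed

end

context mixing_process
begin

lemma K_ge_1: "K \<ge> 1"
  using append_le_mult[of "[]" "[]"] by (simp add: m_Nil)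

text \<open>Adding \<open>ln K\<close> turns subadditivity up to a constant into true subadditivity
  without changing the limit. The infimum form gives a bound at every finite
  \<open>n\<close>.\<close>

definition cross_rate :: "('a list \<Rightarrow> real) \<Rightarrow> ereal" where
  "cross_rate l = (INF n\<in>{1..}. ereal ((cross A l m n + ln K) / real n))"

lemma cross_add_le:
  assumes "shift_process A l" and ac: "\<forall>w\<in>lists A. m w = 0 \<longrightarrow> l w = 0"
  shows "cross A l m (i + j) \<le> cross A l m i + cross A l m j + ln K"
proof -
  interpret l: shift_process A l by fact
  have pt: "l (u @ v) * ln (m (u @ v)) \<le> l (u @ v) * ln K + l (u @ v) * (ln (m u) + ln (m v))"
    if "u \<in> wlists A i" "v \<in> wlists A j" for u v
  proof (cases "l (u @ v) = 0")
    case False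
    note uv = that[THEN in_wlists_lists]
    have *: "m (u @ v) > 0" using False ac[rule_format, of "u @ v"] uv m_nonneg[of "u @ v"] by (auto simp: less_le)
    have le: "m (u @ v) \<le> K * m u * m v" by (rule append_le_mult[OF uv])
    then have "K * m u * m v \<noteq> 0" using * by auto
    then have pos: "m u > 0" "m v > 0" using m_nonneg[of u] m_nonneg[of v] by auto
    have "ln (m (u @ v)) \<le> ln (K * m u * m v)" using le * by simp
    also have "\<dots> = ln K + (ln (m u) + ln (m v))" using pos K_pos by (simp add: ln_mult)
    finally show ?thesis 
      using mult_left_mono[OF _ l.m_nonneg[of "u @ v"]] by (metis distrib_left)
  qed simp
  have "(\<Sum>u\<in>wlists A i. \<Sum>v\<in>wlists A j. l (u @ v)) = 1"
    using l.sum_wlists[of "i + j"] by (simp add: sum_wlists_add)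
  then have K: "(\<Sum>u\<in>wlists A i. \<Sum>v\<in>wlists A j. l (u @ v) * ln K) = ln K"
    by (simp add: sum_distrib_right[symmetric])
  have "cross A l m (i + j)
      \<le> (\<Sum>u\<in>wlists A i. \<Sum>v\<in>wlists A j. l (u @ v) * ln K + l (u @ v) * (ln (m u) + ln (m v)))"
    unfolding cross_def sum_wlists_add by (intro sum_mono pt)
  also have "\<dots> = ln K + (cross A l m i + cross A l m j)"
    unfolding sum.distrib K l.sum_append_split cross_def ..
  finally show ?thesis by simp
qed

lemma cross_tendsto:
  assumes "shift_process A l" and ac: "\<forall>w\<in>lists A. m w = 0 \<longrightarrow> l w = 0"
  shows "(\<lambda>n. ereal (cross A l m n / real n)) \<longlonglongrightarrow> cross_rate l"
proof -
  have "(\<lambda>n. ereal ((cross A l m n + ln K) / real n)) \<longlonglongrightarrow> cross_rate l"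
    unfolding cross_rate_def
  proof (rule fekete)
    show "cross A l m (i + j) + ln K \<le> cross A l m i + ln K + (cross A l m j + ln K)" for i j
      using cross_add_le[OF assms, of i j] by simp
  qed
  moreover have "(\<lambda>n. ereal (- ln K / real n)) \<longlonglongrightarrow> ereal 0"
    unfolding lim_ereal by (rule lim_const_over_n)
  ultimately have "(\<lambda>n. ereal ((cross A l m n + ln K) / real n) + ereal (- ln K / real n)) \<longlonglongrightarrow> cross_rate l + ereal 0"
    by (intro tendsto_add_ereal_general1) auto
  then show ?thesis by (simp add: add_divide_distrib)
qed

lemma ent_plus_cross_rate:
  assumes "shift_process A l" and ac: "\<forall>w\<in>lists A. m w = 0 \<longrightarrow> l w = 0"
  shows "ereal (shift_process.ent_rate A l) + cross_rate l \<le> 0"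
proof -
  interpret l: shift_process A l by fact
  have "(\<lambda>n. ereal (ent A l n / real n) + ereal (cross A l m n / real n)) \<longlonglongrightarrow> ereal l.ent_rate + cross_rate l"
    using l.ent_tendsto by (intro tendsto_add_ereal_general2 cross_tendsto assms) auto
  moreover have "ereal (ent A l n / real n) + ereal (cross A l m n / real n) \<le> 0" for n
  proof -
    have "ent A l n + cross A l m n \<le> 0"
      using rel_ent_nonneg[OF shift_process_axioms assms, of n]
        rel_ent_eq[of l m A n] ac l.m_nonneg m_nonneg by simp
    then show ?thesis by (simp add: add_divide_distrib[symmetric] divide_nonpos_nonneg)
  qed
  ultimately show ?thesis by (intro LIMSEQ_le_const2) auto
qed

lemma ent_plus_cross_rate_self: "ereal ent_rate + cross_rate m = 0"
proof -
  have "(\<lambda>n. ereal (ent A m n / real n) + ereal (cross A m m n / real n)) \<longlonglongrightarrow> ereal ent_rate + cross_rate m"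
    using ent_tendsto by (intro tendsto_add_ereal_general2 cross_tendsto shift_process_axioms) auto
  moreover have "ereal (ent A m n / real n) + ereal (cross A m m n / real n) = 0" for n
    by (simp add: ent_def cross_def)
  ultimately show ?thesis by (simp add: LIMSEQ_const_iff zero_ereal_def)
qed

text \<open>A vanishing relative entropy rate alone would only give growth \<open>o(n)\<close>. But
  both rates are infima of quotients, so they bound \<open>ent\<close> and
  \<open>cross + ln K\<close> from below at each \<open>n >= 1\<close>; the linear terms cancel and
  \<open>ln K\<close> remains.\<close>

lemma eq_if_ent_plus_cross_rate_zero:
  assumes l: "shift_process A l" and ac: "\<forall>w\<in>lists A. m w = 0 \<longrightarrow> l w = 0"
    and zero: "ereal (shift_process.ent_rate A l) + cross_rate l = 0" and w: "w \<in> lists A"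
  shows "l w = m w"
proof (rule eqI[OF l ac _ w])
  interpret l: shift_process A l by fact
  fix n
  have cr: "cross_rate l = ereal (- l.ent_rate)" using zero by (cases "cross_rate l") auto
  show "rel_ent A l m n \<le> ln K"
  proof (cases "n = 0")
    case True
    then show ?thesis using K_ge_1 by (simp add: rel_ent_def m_Nil l.m_Nil)
  next
    case False
    then have "cross_rate l \<le> ereal ((cross A l m n + ln K) / real n)"
      unfolding cross_rate_def by (intro INF_lower) simp
    then have "- l.ent_rate * real n \<le> cross A l m n + ln K" using False by (simp add: cr field_simps)
    moreover have "l.ent_rate * real n \<le> ent A l n" using l.ent_rate_le[of n] False by (simp add: field_simps)
    ultimately show ?thesis
      using rel_ent_eq[of l m A n] ac l.m_nonneg m_nonneg by simp
  qed
qed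

end

section \<open>Measures on sequence spaces\<close>

lemma shiftn_apply: "shiftn n x i = x (i + n)"
  by (simp add: shiftn_def)

lemma shiftn_Suc: "shiftn (Suc n) x = shift (shiftn n x)"
  by (simp add: shiftn_def shift_def)

lemma shiftn_0 [simp]: "shiftn 0 x = x"
  by (simp add: shiftn_def)

lemma shiftn_in:
  assumes "shift ` X \<subseteq> X" "x \<in> X"
  shows "shiftn n x \<in> X"
  using assms by (induction n) (auto simp: shiftn_Suc)

lemma prefix_nth [simp]: "i < n \<Longrightarrow> prefix x n ! i = x i"
  by (simp add: prefix_def)

lemma length_prefix [simp]: "length (prefix x n) = n"
  by (simp add: prefix_def)

lemma prefix_eq_iff: "prefix x n = w \<longleftrightarrow> length w = n \<and> (\<forall>i<n. x i = w ! i)"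
  by (auto simp: list_eq_iff_nth_eq)

lemma in_cyl_iff: "x \<in> cyl X w \<longleftrightarrow> x \<in> X \<and> prefix x (length w) = w"
  by (simp add: cyl_def prefix_eq_iff)

lemma cyl_Nil [simp]: "cyl X [] = X"
  by (simp add: cyl_def)

lemma cyl_eq_Int: "cyl X w = X \<inter> cyl UNIV w"
  by (auto simp: cyl_def)

lemma prefix_add: "prefix x (i + j) = prefix x i @ prefix (shiftn i x) j"
  by (rule nth_equalityI) (auto simp: nth_append shiftn_apply)

lemma prefix_Suc: "prefix x (Suc n) = x 0 # prefix (shift x) n"
  using prefix_add[of x 1 n] by (simp add: prefix_def shiftn_def shift_def)

lemma in_cyl_append:
  assumes "shift ` X \<subseteq> X"
  shows "x \<in> cyl X (u @ v) \<longleftrightarrow> x \<in> cyl X u \<and> shiftn (length u) x \<in> cyl X v"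
  using shiftn_in[OF assms] by (auto simp: in_cyl_iff prefix_add)

lemma words_eq: "words X n = (\<lambda>x. prefix x n) ` X"
  by (auto simp: words_def prefix_eq_iff image_iff) (metis prefix_eq_iff)+

lemma cyl_eq_empty_iff: "cyl X w = {} \<longleftrightarrow> w \<notin> words X (length w)"
  by (auto simp: words_def cyl_def)

lemma cyl_Int:
  "cyl X u \<inter> cyl X v \<in> insert {} (range (cyl X))"
proof -
  have *: "cyl X u \<inter> cyl X v \<in> {{}, cyl X v}" if "length u \<le> length v" for u v
  proof (cases "take (length u) v = u")
    case True
    then have "cyl X v \<subseteq> cyl X u"
      using that by (auto simp: cyl_def) (metis nth_take order_less_le_trans)
    then show ?thesis by auto
  next
    case False
    have "cyl X u \<inter> cyl X v = {}"
    proof (rule equals0I)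
      fix x assume "x \<in> cyl X u \<inter> cyl X v"
      then have "take (length u) v = u"
        using that by (intro nth_equalityI) (auto simp: cyl_def)
      with False show False by simp
    qed
    then show ?thesis by simp
  qed
  show ?thesis using *[of u v] *[of v u] by (cases "length u \<le> length v") (auto simp: Int_commute)
qed

lemma open_contains_cyl:
  assumes "open U" "x \<in> U"
  shows "\<exists>n. cyl UNIV (prefix x n) \<subseteq> U"
proof -
  have "openin (product_topology (\<lambda>i. euclidean) UNIV) U" using assms(1) by (simp add: open_fun_def)
  from product_topology_open_contains_basis[OF this assms(2)]
  obtain V where V: "x \<in> (\<Pi>\<^sub>E i\<in>UNIV. V i)" "finite {i. V i \<noteq> (UNIV :: nat set)}" "(\<Pi>\<^sub>E i\<in>UNIV. V i) \<subseteq> U"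
    by auto
  define n where "n = Suc (Max (insert 0 {i. V i \<noteq> UNIV}))"
  have n: "i < n" if "V i \<noteq> UNIV" for i
    using V(2) that by (auto simp: n_def less_Suc_eq_le intro!: Max_ge)
  have "cyl UNIV (prefix x n) \<subseteq> (\<Pi>\<^sub>E i\<in>UNIV. V i)"
  proof
    fix y assume "y \<in> cyl UNIV (prefix x n)"
    then have "y i = x i" if "i < n" for i using that by (auto simp: cyl_def)
    then have "y i \<in> V i" for i using n[of i] V(1) by (cases "V i = UNIV") (auto simp: PiE_def Pi_def)
    then show "y \<in> (\<Pi>\<^sub>E i\<in>UNIV. V i)" by auto
  qed
  with V(3) show ?thesis by blast
qed

lemma open_cyl_UNIV: "open (cyl UNIV w)"
proof -
  have "cyl UNIV w = (\<Inter>i\<in>{..<length w}. (\<lambda>x. x i) -` {w ! i})" by (auto simp: cyl_def)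
  also have "open \<dots>"
    by (intro open_INT ballI open_vimage finite_lessThan continuous_on_product_coordinates discrete_topology_class.open_discrete)
  finally show ?thesis .
qed

lemma sets_borel_seq: "sets (borel :: (nat \<Rightarrow> nat) measure) = sigma_sets UNIV (range (cyl UNIV))"
proof -
  have "(borel :: (nat \<Rightarrow> nat) measure) = sigma UNIV (range (cyl UNIV))"
    unfolding borel_def
  proof (rule sigma_eqI, simp, simp, rule sigma_sets_eqI)
    fix U :: "(nat \<Rightarrow> nat) set" assume "U \<in> {S. open S}"
    then have U: "open U" by simp
    \<comment> \<open>There are only countably many words, so this union stays in the
      sigma-algebra.\<close>
    have "U = \<Union> (cyl UNIV ` {w. cyl UNIV w \<subseteq> U})"
      using open_contains_cyl[OF U] by (auto simp: in_cyl_iff) (metis in_cyl_iff length_prefix mem_Collect_eq UNIV_I)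
    moreover have "\<Union> (cyl UNIV ` {w. cyl UNIV w \<subseteq> U}) \<in> sigma_sets UNIV (range (cyl UNIV))"
      by (rule sigma_sets_UNION) auto
    ultimately show "U \<in> sigma_sets UNIV (range (cyl UNIV))" by simp
  next
    fix U :: "(nat \<Rightarrow> nat) set" assume "U \<in> range (cyl UNIV)"
    then show "U \<in> sigma_sets UNIV {S. open S}" by (auto intro: sigma_sets.Basic open_cyl_UNIV)
  qed
  then have "sets (borel :: (nat \<Rightarrow> nat) measure) = sets (sigma UNIV (range (cyl UNIV)))" by (rule arg_cong)
  also have "\<dots> = sigma_sets UNIV (range (cyl UNIV))" by (rule sets_measure_of) simp
  finally show ?thesis .
qed

text \<open>Closedness makes \<open>X\<close> Borel, so the traces of the cylinders generate the
  trace sigma-algebra. Inserting \<open>{}\<close> makes the generator stable under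
  intersection.\<close>

lemma sets_borel_on:
  assumes "closed X"
  shows "sets (borel_on X) = sigma_sets X (insert {} (range (cyl X)))"
proof -
  have X: "X \<in> sigma_sets UNIV (range (cyl UNIV))"
    using assms unfolding sets_borel_seq[symmetric] by simp
  have "sets (borel_on X) = (\<inter>) X ` sigma_sets UNIV (range (cyl UNIV))"
    by (simp add: borel_on_def sets_restrict_space sets_borel_seq)
  also have "\<dots> = sigma_sets X ((\<inter>) X ` range (cyl UNIV))"
    using X by (rule sigma_sets_Int) simp
  also have "(\<inter>) X ` range (cyl UNIV) = range (cyl X)"
    by (simp add: image_image cyl_eq_Int[of X, symmetric])
  also have "sigma_sets X (range (cyl X)) = sigma_sets X (insert {} (range (cyl X)))"
    by (rule sigma_sets_eqI) (auto intro: sigma_sets.Basic sigma_sets.Empty)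
  finally show ?thesis .
qed

lemma space_borel_on: "space (borel_on X) = X"
  by (simp add: borel_on_def space_restrict_space)

lemma shift_measurable:
  assumes "shift ` X \<subseteq> X"
  shows "shift \<in> measurable (borel_on X) (borel_on X)"
proof -
  have "continuous_on X shift"
    unfolding shift_def[abs_def]
    by (intro continuous_on_coordinatewise_then_product)
      (rule continuous_on_subset[OF continuous_on_product_coordinates], simp)
  then have "shift \<in> borel_measurable (borel_on X)"
    unfolding borel_on_def by (rule borel_measurable_continuous_on_restrict)
  then show ?thesis
    using assms unfolding borel_on_def[of X]
    by (intro measurable_restrict_space2) (auto simp: space_restrict_space)
qed

locale borel_prob_on = prob_space \<mu> for \<mu> :: "(nat \<Rightarrow> nat) measure" +
  fixes X :: "(nat \<Rightarrow> nat) set"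
  assumes closed_X: "closed X" and sets_eq: "sets \<mu> = sets (borel_on X)"
begin

lemma space_eq: "space \<mu> = X"
  using sets_eq_imp_space_eq[OF sets_eq] by (simp add: space_borel_on)

lemma sets_eq_sigma: "sets \<mu> = sigma_sets X (insert {} (range (cyl X)))"
  by (simp add: sets_eq sets_borel_on[OF closed_X])

lemma cyl_sets [measurable, simp]: "cyl X w \<in> sets \<mu>"
  by (auto simp: sets_eq_sigma intro: sigma_sets.Basic)

end

lemma borel_prob_onI: "closed X \<Longrightarrow> \<mu> \<in> borel_prob X \<Longrightarrow> borel_prob_on \<mu> X"
  by (simp add: borel_prob_def borel_prob_on_def borel_prob_on_axioms_def)

lemma Int_stable_cyl: "Int_stable (insert {} (range (cyl X)))"
  using cyl_Int by (auto simp: Int_stable_def)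

lemma borel_prob_eqI:
  assumes "borel_prob_on \<mu> X" "borel_prob_on \<nu> X"
    and eq: "\<And>w. measure \<mu> (cyl X w) = measure \<nu> (cyl X w)"
  shows "\<mu> = \<nu>"
proof -
  interpret m: borel_prob_on \<mu> X by fact
  interpret n: borel_prob_on \<nu> X by fact
  show ?thesis
  proof (rule measure_eqI_generator_eq[OF Int_stable_cyl[of X], where \<Omega> = X and A = "\<lambda>_. X"])
    show "range (\<lambda>_::nat. X) \<subseteq> insert {} (range (cyl X))" using cyl_Nil by blast
    show "insert {} (range (cyl X)) \<subseteq> Pow X" by (auto simp: cyl_def)
  qed (use eq in \<open>auto simp: m.sets_eq_sigma n.sets_eq_sigma m.emeasure_eq_measure n.emeasure_eq_measure\<close>)
qed

text \<open>\<open>A\<close> only has to contain the letters that occur: words over \<open>A\<close>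
  outside the language have measure 0, so entropy sums over \<open>words X n\<close> and
  \<open>wlists A n\<close> agree.\<close>

locale invariant_on = borel_prob_on +
  fixes A :: "nat set"
  assumes shift_X: "shift ` X \<subseteq> X"
    and finite_A: "finite A" and range_A: "\<And>x i. x \<in> X \<Longrightarrow> x i \<in> A"
    and invariant: "\<And>B. B \<in> sets \<mu> \<Longrightarrow> measure \<mu> (shift -` B \<inter> X) = measure \<mu> B"
begin

abbreviation "m \<equiv> \<lambda>w. measure \<mu> (cyl X w)"

lemma prefix_in_wlists: "x \<in> X \<Longrightarrow> prefix x n \<in> wlists A n"
  by (auto simp: wlists_def prefix_def range_A)

lemma shift_in: "x \<in> X \<Longrightarrow> shift x \<in> X"
  using shift_X by blast

lemma words_subset: "words X n \<subseteq> wlists A n"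
  by (auto simp: words_eq prefix_in_wlists)

lemma measure_zero_outside: "w \<in> wlists A n \<Longrightarrow> w \<notin> words X n \<Longrightarrow> m w = 0"
  using cyl_eq_empty_iff[of X w] wlists_length[of w A n] by auto

lemma measure_partition:
  assumes "B \<in> sets \<mu>" "\<And>x. x \<in> B \<Longrightarrow> h x \<in> I" "finite I" "\<And>i. i \<in> I \<Longrightarrow> B \<inter> h -` {i} \<in> sets \<mu>"
  shows "measure \<mu> B = (\<Sum>i\<in>I. measure \<mu> (B \<inter> h -` {i}))"
proof -
  have "measure \<mu> (\<Union>i\<in>I. B \<inter> h -` {i}) = (\<Sum>i\<in>I. measure \<mu> (B \<inter> h -` {i}))"
    using assms by (intro finite_measure_finite_Union) (auto simp: disjoint_family_on_def)
  moreover have "(\<Union>i\<in>I. B \<inter> h -` {i}) = B" using assms(2) by auto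
  ultimately show ?thesis by simp
qed

lemma shift_process: "shift_process A m"
proof
  fix w assume "w \<in> lists A"
  have 1: "cyl X w \<inter> (\<lambda>x. x (length w)) -` {a} = cyl X (w @ [a])" for a
    by (auto simp: cyl_def nth_append less_Suc_eq)
  show "(\<Sum>a\<in>A. m (w @ [a])) = m w"
    using measure_partition[of "cyl X w" "\<lambda>x. x (length w)" A] range_A finite_A
    by (simp add: 1) (simp add: cyl_def)
  have 2: "shift -` cyl X w \<inter> X \<inter> (\<lambda>x. x 0) -` {a} = cyl X (a # w)" for a
    using shift_in by (auto simp: in_cyl_iff prefix_Suc)
  have "shift -` cyl X w \<inter> X = (\<Union>a\<in>A. cyl X (a # w))"
    using range_A by (auto simp: 2[symmetric])
  then have "shift -` cyl X w \<inter> X \<in> sets \<mu>" using finite_A by auto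
  then show "(\<Sum>a\<in>A. m (a # w)) = m w"
    using measure_partition[of "shift -` cyl X w \<inter> X" "\<lambda>x. x 0" A] range_A finite_A invariant[of "cyl X w"]
    by (simp add: 2)
qed (use finite_A space_eq prob_space in auto)

sublocale m: shift_process A m by (rule shift_process)

text \<open>Partition of the event by the word read in the gap.\<close>

lemma measure_cyl_Int_shiftn:
  "measure \<mu> (cyl X u \<inter> (shiftn (length u + k) -` cyl X v \<inter> X)) = joint A m k u v"
proof -
  have eq: "(cyl X u \<inter> (shiftn (length u + k) -` cyl X v \<inter> X)) \<inter> (\<lambda>x. prefix (shiftn (length u) x) k) -` {w}
      = cyl X (u @ w @ v)" if "w \<in> wlists A k" for w
  proof -
    have "shiftn (length w) (shiftn (length u) x) = shiftn (length u + k) x" for x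
      using wlists_length[OF that] by (simp add: shiftn_def add_ac)
    then show ?thesis
      using shiftn_in[OF shift_X] wlists_length[OF that]
      by (auto simp: in_cyl_append[OF shift_X]) (auto simp: in_cyl_iff)
  qed
  have "cyl X u \<inter> (shiftn (length u + k) -` cyl X v \<inter> X) = (\<Union>w\<in>wlists A k. cyl X (u @ w @ v))"
    using prefix_in_wlists shiftn_in[OF shift_X] by (auto simp: eq[symmetric] in_cyl_iff)
  also have "\<dots> \<in> sets \<mu>" using finite_wlists[OF finite_A] by auto
  finally have S: "cyl X u \<inter> (shiftn (length u + k) -` cyl X v \<inter> X) \<in> sets \<mu>" .
  show ?thesis
    unfolding joint_def
    using measure_partition[OF S, of "\<lambda>x. prefix (shiftn (length u) x) k" "wlists A k"]
    by (simp add: eq finite_wlists finite_A prefix_in_wlists shiftn_in[OF shift_X] in_cyl_iff cong: sum.cong)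
qed

lemma shiftn_vimage_sets: "B \<in> sets \<mu> \<Longrightarrow> shiftn n -` B \<inter> X \<in> sets \<mu>"
  and measure_shiftn: "B \<in> sets \<mu> \<Longrightarrow> measure \<mu> (shiftn n -` B \<inter> X) = measure \<mu> B"
proof -
  have "shift \<in> measurable \<mu> \<mu>"
    using shift_measurable[OF shift_X] by (simp only: measurable_cong_sets[OF sets_eq sets_eq])
  then have meas: "shift -` B \<inter> X \<in> sets \<mu>" if "B \<in> sets \<mu>" for B
    using that space_eq by (auto dest: measurable_sets)
  have "shiftn n -` B \<inter> X \<in> sets \<mu> \<and> measure \<mu> (shiftn n -` B \<inter> X) = measure \<mu> B" if "B \<in> sets \<mu>"
    using that
  proof (induction n arbitrary: B)
    case 0
    then show ?case using sets.sets_into_space[of B \<mu>] by (simp add: space_eq Int_absorb2 vimage_def)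
  next
    case (Suc n)
    have "shiftn (Suc n) -` B \<inter> X = shiftn n -` (shift -` B \<inter> X) \<inter> X"
      using shiftn_in[OF shift_X] by (auto simp: shiftn_Suc)
    then show ?case using Suc.IH[OF meas[OF Suc.prems]] invariant[OF Suc.prems] by simp
  qed
  then show "B \<in> sets \<mu> \<Longrightarrow> shiftn n -` B \<inter> X \<in> sets \<mu>"
    and "B \<in> sets \<mu> \<Longrightarrow> measure \<mu> (shiftn n -` B \<inter> X) = measure \<mu> B" by auto
qed

lemma entropy_ms_eq: "entropy_ms X \<mu> = m.ent_rate"
proof -
  have "(\<Sum>w\<in>words X n. m w * ln (m w)) = (\<Sum>w\<in>wlists A n. m w * ln (m w))" for n
    by (rule sum.mono_neutral_left) (auto simp: finite_wlists finite_A words_subset measure_zero_outside)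
  then show ?thesis by (simp add: entropy_ms_def m.ent_rate_def ent_def)
qed

end

lemma invariant_onI:
  assumes "closed X" "shift ` X \<subseteq> X" "finite A" "\<And>x i. x \<in> X \<Longrightarrow> x i \<in> A" "\<mu> \<in> invariant_measures X"
  shows "invariant_on \<mu> X A"
proof -
  interpret borel_prob_on \<mu> X using assms by (intro borel_prob_onI) (auto simp: invariant_measures_def)
  show ?thesis
    using assms by unfold_locales (auto simp: invariant_measures_def measure_def)
qed

section \<open>Mixing: from cylinders to Borel sets\<close>

context borel_prob_on
begin

lemma sets_induct [consumes 1, case_names cyl compl union]:
  assumes S: "S \<in> sets \<mu>"
    and cyl: "\<And>w. Q (cyl X w)"
    and compl: "\<And>S. S \<in> sets \<mu> \<Longrightarrow> Q S \<Longrightarrow> Q (X - S)"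
    and union: "\<And>F :: nat \<Rightarrow> (nat \<Rightarrow> nat) set. disjoint_family F \<Longrightarrow> range F \<subseteq> sets \<mu> \<Longrightarrow> (\<And>i. Q (F i)) \<Longrightarrow> Q (\<Union>i. F i)"
  shows "Q S"
proof -
  have "Q X" using cyl[of "[]"] by simp
  then have empty: "Q {}" using compl[of X] cyl_sets[of "[]"] by simp
  show ?thesis
  proof (rule sigma_sets_induct_disjoint[OF Int_stable_cyl[of X], of X S Q])
    show "insert {} (range (cyl X)) \<subseteq> Pow X" by (auto simp: cyl_def)
    show "S \<in> sigma_sets X (insert {} (range (cyl X)))" using S by (simp add: sets_eq_sigma)
  qed (use cyl compl union empty in \<open>auto simp: sets_eq_sigma[symmetric]\<close>)
qed

end

context finite_measure
begin

text \<open>Dominated convergence for series, with the summable majorant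
  \<open>measure M (F i)\<close>; it is the disjoint union step of both inductions for
  mixing.\<close>

lemma tendsto_measure_UNION:
  fixes F :: "nat \<Rightarrow> 'a set" and G :: "nat \<Rightarrow> nat \<Rightarrow> 'a set"
  assumes F: "disjoint_family F" "range F \<subseteq> sets M"
    and G: "\<And>n. disjoint_family (G n)" "\<And>n. range (G n) \<subseteq> sets M"
    and dom: "\<And>n i. measure M (G n i) \<le> measure M (F i)"
    and lim: "\<And>i. (\<lambda>n. measure M (G n i)) \<longlonglongrightarrow> measure M (F i) * b"
  shows "(\<lambda>n. measure M (\<Union>i. G n i)) \<longlonglongrightarrow> measure M (\<Union>i. F i) * b"
proof -
  note sums = finite_measure_UNION[OF F(2,1)]
  have "((\<lambda>n. \<Sum>i. measure M (G n i)) \<longlongrightarrow> (\<Sum>i. measure M (F i) * b)) sequentially"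
  proof (rule tannerys_theorem[where M = "\<lambda>i. measure M (F i)", THEN conjunct2, THEN conjunct2])
    show "\<forall>\<^sub>F (k, n) in at_top \<times>\<^sub>F sequentially. norm (measure M (G n k)) \<le> measure M (F k)"
      by (intro always_eventually) (simp add: dom split_beta)
  qed (use lim sums in \<open>auto simp: sums_iff\<close>)
  moreover have "(\<Sum>i. measure M (F i) * b) = measure M (\<Union>i. F i) * b"
    using sums_unique[OF sums_mult2[OF sums, of b]] by simp
  moreover have "(\<Sum>i. measure M (G n i)) = measure M (\<Union>i. G n i)" for n
    using sums_unique[OF finite_measure_UNION[OF G(2,1)]] by simp
  ultimately show ?thesis by simp
qed

end

locale mixing_on = invariant_on +
  fixes c K :: real and p :: nat
  assumes mixing_process: "mixing_process A m c K p"
begin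

sublocale m: mixing_process A m c K p by (rule mixing_process)

lemma cyl_tendsto:
  "(\<lambda>n. measure \<mu> (cyl X u \<inter> (shiftn n -` cyl X v \<inter> X))) \<longlonglongrightarrow> m u * m v"
proof (cases "u \<in> lists A \<and> v \<in> lists A")
  case True
  then have "(\<lambda>n. joint A m n u v) \<longlonglongrightarrow> m u * m v" by (intro m.joint_tendsto) auto
  then show ?thesis
    using LIMSEQ_offset[of "\<lambda>n. measure \<mu> (cyl X u \<inter> (shiftn n -` cyl X v \<inter> X))" "length u"]
    by (simp add: measure_cyl_Int_shiftn[symmetric] add.commute)
next
  case False
  have "cyl X w = {}" if "w \<notin> lists A" for w
    using that by (metis equals0I in_cyl_iff in_wlists_lists prefix_in_wlists)
  then have "cyl X u = {} \<or> cyl X v = {}" using False by blast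
  then show ?thesis by auto
qed

lemma mixing: "mixing X \<mu>"
proof -
  \<comment> \<open>Induction over the first set with the second one a cylinder; a second induction
    then frees the second set.\<close>
  have 1: "(\<lambda>n. measure \<mu> (S \<inter> (shiftn n -` cyl X v \<inter> X))) \<longlonglongrightarrow> measure \<mu> S * m v"
    if "S \<in> sets \<mu>" for S v
    using that
  proof (induction rule: sets_induct)
    case (cyl w)
    then show ?case by (rule cyl_tendsto)
  next
    case (compl S)
    have "measure \<mu> ((X - S) \<inter> (shiftn n -` cyl X v \<inter> X)) = m v - measure \<mu> (S \<inter> (shiftn n -` cyl X v \<inter> X))" for n
    proof -
      have "(X - S) \<inter> (shiftn n -` cyl X v \<inter> X) = (shiftn n -` cyl X v \<inter> X) - S \<inter> (shiftn n -` cyl X v \<inter> X)" by auto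
      then show ?thesis
        using compl shiftn_vimage_sets[OF cyl_sets, of n v]
        by (simp only:) (subst finite_measure_Diff, auto simp: measure_shiftn)
    qed
    moreover have "(\<lambda>n. m v - measure \<mu> (S \<inter> (shiftn n -` cyl X v \<inter> X))) \<longlonglongrightarrow> m v - measure \<mu> S * m v"
      by (intro tendsto_diff tendsto_const compl)
    moreover have "measure \<mu> (X - S) = 1 - measure \<mu> S" using compl(1) prob_compl[of S] by (simp add: space_eq)
    ultimately show ?case by (simp add: left_diff_distrib)
  next
    case (union F)
    have "(\<lambda>n. measure \<mu> (\<Union>i. F i \<inter> (shiftn n -` cyl X v \<inter> X))) \<longlonglongrightarrow> measure \<mu> (\<Union>i. F i) * m v"
    proof (rule tendsto_measure_UNION[OF union(1,2) _ _ _ union(3)])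
      show "disjoint_family (\<lambda>i. F i \<inter> (shiftn n -` cyl X v \<inter> X))" for n
        using union(1) by (auto simp: disjoint_family_on_def)
      show "range (\<lambda>i. F i \<inter> (shiftn n -` cyl X v \<inter> X)) \<subseteq> sets \<mu>" for n
        using union(2) shiftn_vimage_sets[OF cyl_sets, of n v] by (auto simp: subset_iff)
      show "measure \<mu> (F i \<inter> (shiftn n -` cyl X v \<inter> X)) \<le> measure \<mu> (F i)" for n i
        using union(2) by (intro finite_measure_mono) auto
    qed
    moreover have "(\<Union>i. F i \<inter> (shiftn n -` cyl X v \<inter> X)) = (\<Union>i. F i) \<inter> (shiftn n -` cyl X v \<inter> X)" for n
      by blast
    ultimately show ?case by simp
  qed
  have 2: "(\<lambda>n. measure \<mu> (B \<inter> (shiftn n -` S \<inter> X))) \<longlonglongrightarrow> measure \<mu> S * measure \<mu> B"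
    if S: "S \<in> sets \<mu>" and B: "B \<in> sets \<mu>" for S B
    using S
  proof (induction rule: sets_induct)
    case (cyl w)
    then show ?case using 1[OF B, of w] by (simp add: mult.commute)
  next
    case (compl S)
    have "measure \<mu> (B \<inter> (shiftn n -` (X - S) \<inter> X)) = measure \<mu> B - measure \<mu> (B \<inter> (shiftn n -` S \<inter> X))" for n
    proof -
      have "B \<inter> (shiftn n -` (X - S) \<inter> X) = B - B \<inter> (shiftn n -` S \<inter> X)"
        using shiftn_in[OF shift_X] sets.sets_into_space[OF B] by (auto simp: space_eq)
      then show ?thesis
        using compl B shiftn_vimage_sets[of S n]
        by (simp only:) (subst finite_measure_Diff, auto)
    qed
    moreover have "(\<lambda>n. measure \<mu> B - measure \<mu> (B \<inter> (shiftn n -` S \<inter> X))) \<longlonglongrightarrow> measure \<mu> B - measure \<mu> S * measure \<mu> B"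
      by (intro tendsto_diff tendsto_const compl)
    moreover have "measure \<mu> (X - S) = 1 - measure \<mu> S" using compl(1) prob_compl[of S] by (simp add: space_eq)
    ultimately show ?case by (simp add: left_diff_distrib)
  next
    case (union F)
    \<comment> \<open>The intersection lies in the preimage of \<open>F i\<close>, which by
      invariance has the measure of \<open>F i\<close>; hence the majorant does not depend on
      \<open>n\<close>.\<close>
    have dom: "measure \<mu> (B \<inter> (shiftn n -` F i \<inter> X)) \<le> measure \<mu> (F i)" for n i
      using union(2) shiftn_vimage_sets[of "F i" n] measure_shiftn[of "F i" n]
        finite_measure_mono[of "B \<inter> (shiftn n -` F i \<inter> X)" "shiftn n -` F i \<inter> X"] by auto
    have "(\<lambda>n. measure \<mu> (\<Union>i. B \<inter> (shiftn n -` F i \<inter> X))) \<longlonglongrightarrow> measure \<mu> (\<Union>i. F i) * measure \<mu> B"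
    proof (rule tendsto_measure_UNION[OF union(1,2) _ _ dom union(3)])
      show "disjoint_family (\<lambda>i. B \<inter> (shiftn n -` F i \<inter> X))" for n
        using union(1) by (auto simp: disjoint_family_on_def)
      show "range (\<lambda>i. B \<inter> (shiftn n -` F i \<inter> X)) \<subseteq> sets \<mu>" for n
        using union(2) shiftn_vimage_sets B by (auto simp: subset_iff)
    qed
    moreover have "(\<Union>i. B \<inter> (shiftn n -` F i \<inter> X)) = B \<inter> (shiftn n -` (\<Union>i. F i) \<inter> X)" for n
      by auto
    ultimately show ?case by simp
  qed
  show ?thesis
    unfolding mixing_def
  proof (intro ballI)
    fix B S assume "B \<in> sets \<mu>" "S \<in> sets \<mu>"
    then show "(\<lambda>n. measure \<mu> (B \<inter> (shiftn n -` S \<inter> X))) \<longlonglongrightarrow> measure \<mu> B * measure \<mu> S"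
      using 2[of S B] by (simp only: mult.commute)
  qed
qed

end

section \<open>Gibbs measures\<close>

text \<open>\<open>P\<close> is a free parameter here and is identified as the pressure only in
  \<open>pressure_eq\<close>. This allows the constant of \<open>X\<close> to be carried to
  \<open>Y\<close> before anything is known about the pressure of \<open>g\<close>.\<close>

locale gibbs_subshift = mixing_on +
  fixes \<phi> :: "nat \<Rightarrow> (nat \<Rightarrow> nat) \<Rightarrow> real" and P C :: real
  assumes potential: "potential X \<phi>" and C_pos: "C > 0"
    and gibbs_lower: "\<And>x n. x \<in> X \<Longrightarrow> n \<ge> 1 \<Longrightarrow> \<phi> n x \<le> C * exp (n * P) * m (prefix x n)"
    and gibbs_upper: "\<And>x n. x \<in> X \<Longrightarrow> n \<ge> 1 \<Longrightarrow> m (prefix x n) \<le> C * exp (- (n * P)) * \<phi> n x"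
begin

lemma nonempty: "X \<noteq> {}"
  using not_empty by (simp add: space_eq)

lemma \<phi>_pos: "x \<in> X \<Longrightarrow> n \<ge> 1 \<Longrightarrow> \<phi> n x > 0"
  using potential by (simp add: potential_def)

lemma m_prefix_pos: 
  assumes "x \<in> X"
  shows "m (prefix x n) > 0"
proof (cases "n = 0")
  case True
  then show ?thesis using m.m_Nil by (simp add: prefix_def)
next
  case False
  then have "0 < C * exp (n * P) * m (prefix x n)"
    using \<phi>_pos[OF assms, of n] gibbs_lower[OF assms, of n] by simp
  then show ?thesis using C_pos by (simp add: zero_less_mult_iff)
qed

lemma cyl_empty_if_null: "m w = 0 \<Longrightarrow> cyl X w = {}"
  using m_prefix_pos by (metis equals0I in_cyl_iff less_irrefl)

lemma abs_cont: "\<forall>w\<in>lists A. m w = 0 \<longrightarrow> measure \<eta> (cyl X w) = 0"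
  by (metis cyl_empty_if_null measure_empty)

lemma \<phi>_le_\<phi>:
  assumes "x \<in> X" "y \<in> X" "n \<ge> 1" "prefix x n = prefix y n"
  shows "\<phi> n x \<le> C\<^sup>2 * \<phi> n y"
proof -
  have "\<phi> n x \<le> C * exp (n * P) * m (prefix y n)" using gibbs_lower[OF assms(1,3)] assms(4) by simp
  also have "\<dots> \<le> C * exp (n * P) * (C * exp (- (n * P)) * \<phi> n y)"
    using gibbs_upper[OF assms(2,3)] C_pos by (intro mult_left_mono) auto
  also have "\<dots> = C\<^sup>2 * \<phi> n y" by (simp add: power2_eq_square exp_minus field_simps)
  finally show ?thesis .
qed

lemma C_ge_1: "C \<ge> 1"
proof -
  obtain x where x: "x \<in> X" using nonempty by auto
  have "\<phi> 1 x * 1 \<le> \<phi> 1 x * C\<^sup>2" using \<phi>_le_\<phi>[OF x x, of 1] by (simp add: mult.commute)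
  then have "1 \<le> C\<^sup>2" using \<phi>_pos[OF x, of 1] by (subst (asm) mult_le_cancel_left_pos) auto
  then show ?thesis using C_pos by (metis abs_le_square_iff abs_one abs_of_pos one_power2)
qed

lemma bounded_variation: "bounded_variation X \<phi>"
  unfolding bounded_variation_def
proof (intro exI[of _ "C\<^sup>2"] allI impI ballI)
  fix n :: nat and x x' assume *: "n \<ge> 1" "x \<in> X" "x' \<in> X" "\<forall>i<n. x i = x' i"
  then have "prefix x n = prefix x' n" by (simp add: prefix_eq_iff)
  then show "\<phi> n x / \<phi> n x' \<le> C\<^sup>2"
    using \<phi>_le_\<phi>[of x x' n] \<phi>_pos[of x' n] * by (simp add: divide_le_eq)
qed

lemma asymp_subadditive: "asymp_subadditive X \<phi>"
proof -
  \<comment> \<open>One \<open>C\<close> comes from \<open>gibbs_lower\<close> for the long word,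
    two from \<open>gibbs_upper\<close> for its pieces, \<open>K\<close> from
    \<open>append_le_mult\<close>. The single subadditive potential \<open>M * \<phi> n x\<close>
    then serves every epsilon.\<close>
  define M where "M = C ^ 3 * K"
  have M: "M > 0" using C_pos m.K_pos by (simp add: M_def)
  have sub: "\<phi> (i + j) x \<le> M * \<phi> i x * \<phi> j (shiftn i x)" if "i \<ge> 1" "j \<ge> 1" "x \<in> X" for i j x
  proof -
    have sx: "shiftn i x \<in> X" by (rule shiftn_in[OF shift_X that(3)])
    have in_lists: "prefix x i \<in> lists A" "prefix (shiftn i x) j \<in> lists A"
      using prefix_in_wlists[OF that(3)] prefix_in_wlists[OF sx] by (auto dest: in_wlists_lists)
    have "\<phi> (i + j) x \<le> C * exp ((i + j) * P) * m (prefix x i @ prefix (shiftn i x) j)"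
      using gibbs_lower[OF that(3), of "i + j"] that by (simp add: prefix_add)
    also have "\<dots> \<le> C * exp ((i + j) * P) * (K * m (prefix x i) * m (prefix (shiftn i x) j))"
      using C_pos in_lists by (intro mult_left_mono m.append_le_mult) auto
    also have "\<dots> \<le> C * exp ((i + j) * P) * (K * (C * exp (- (i * P)) * \<phi> i x) * (C * exp (- (j * P)) * \<phi> j (shiftn i x)))"
      using C_pos m.K_pos gibbs_upper[OF that(3,1)] gibbs_upper[OF sx that(2)] \<phi>_pos[OF that(3,1)]
      by (intro mult_left_mono mult_mono) auto
    also have "\<dots> = M * \<phi> i x * \<phi> j (shiftn i x)"
      by (simp add: M_def power3_eq_cube exp_add[symmetric] distrib_right exp_minus field_simps)
    finally show ?thesis .
  qed
  have "subadditive X (\<lambda>n x. M * \<phi> n x)"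
    unfolding subadditive_def potential_def
  proof (intro conjI allI impI ballI)
    show "continuous_on X (\<lambda>x. M * \<phi> n x)" if "1 \<le> n" for n
      using that potential by (intro continuous_intros) (simp add: potential_def)
    show "M * \<phi> n x > 0" if "1 \<le> n" "x \<in> X" for n x using M \<phi>_pos that by simp
    show "M * \<phi> (n + j) x \<le> M * \<phi> n x * (M * \<phi> j (shiftn n x))" if "x \<in> X" "1 \<le> n" "1 \<le> j" for n j x
      using mult_left_mono[OF sub[OF that(2,3,1)], of M] M by (simp add: mult_ac)
  qed
  moreover have "limsup (\<lambda>n. ereal ((SUP x\<in>X. \<bar>ln (\<phi> n x) - ln (M * \<phi> n x)\<bar>) / real n)) = 0"
  proof -
    have "(SUP x\<in>X. \<bar>ln (\<phi> n x) - ln (M * \<phi> n x)\<bar>) = \<bar>ln M\<bar>" if "n \<ge> 1" for n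
    proof -
      have "\<bar>ln (\<phi> n x) - ln (M * \<phi> n x)\<bar> = \<bar>ln M\<bar>" if "x \<in> X" for x
        using \<phi>_pos[OF that \<open>n \<ge> 1\<close>] M by (simp add: ln_mult)
      then have "(SUP x\<in>X. \<bar>ln (\<phi> n x) - ln (M * \<phi> n x)\<bar>) = (SUP x\<in>X. \<bar>ln M\<bar>)"
        by (intro SUP_cong refl)
      then show ?thesis using nonempty by simp
    qed
    then have "eventually (\<lambda>n. \<bar>ln M\<bar> / real n = (SUP x\<in>X. \<bar>ln (\<phi> n x) - ln (M * \<phi> n x)\<bar>) / real n) sequentially"
      by (intro eventually_sequentiallyI[of 1]) simp
    then have "(\<lambda>n. (SUP x\<in>X. \<bar>ln (\<phi> n x) - ln (M * \<phi> n x)\<bar>) / real n) \<longlonglongrightarrow> 0"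
      by (rule Lim_transform_eventually[OF lim_const_over_n])
    then have "(\<lambda>n. ereal ((SUP x\<in>X. \<bar>ln (\<phi> n x) - ln (M * \<phi> n x)\<bar>) / real n)) \<longlonglongrightarrow> ereal 0"
      unfolding lim_ereal .
    then show ?thesis by (intro lim_imp_Limsup) (auto simp: zero_ereal_def)
  qed
  ultimately show ?thesis
    unfolding asymp_subadditive_def using potential
    by (auto intro!: exI[of _ "\<lambda>n x. M * \<phi> n x"])
qed

section \<open>Free energy, equilibrium states and uniqueness\<close>

lemma ln_\<phi>_bound:
  assumes "x \<in> X" "n \<ge> 1"
  shows "\<bar>ln (\<phi> n x) - (ln (m (prefix x n)) + n * P)\<bar> \<le> ln C"
proof -
  have pos: "\<phi> n x > 0" "m (prefix x n) > 0" using \<phi>_pos m_prefix_pos assms by auto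
  have "ln (\<phi> n x) \<le> ln (C * exp (n * P) * m (prefix x n))"
    using gibbs_lower[OF assms] pos by simp
  also have "\<dots> = ln C + n * P + ln (m (prefix x n))" using C_pos pos by (simp add: ln_mult)
  finally have "ln (\<phi> n x) \<le> ln C + n * P + ln (m (prefix x n))" .
  moreover have "ln (m (prefix x n)) \<le> ln (C * exp (- (n * P)) * \<phi> n x)"
    using gibbs_upper[OF assms] pos by simp
  moreover have "\<dots> = ln C - n * P + ln (\<phi> n x)" using C_pos pos by (simp add: ln_mult)
  ultimately show ?thesis by linarith
qed

text \<open>The step function \<open>g\<close> equals \<open>ln (m (prefix x n))\<close> on
  \<open>X\<close> and integrates to \<open>cross\<close>; the Gibbs bounds put
  \<open>ln (\<phi> n x) - g x\<close> within \<open>ln C\<close> of \<open>n * P\<close>.\<close>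

lemma integral_ln_\<phi>:
  assumes l: "borel_prob_on \<eta> X" and n: "n \<ge> 1"
  shows "\<bar>(\<integral>x. ln (\<phi> n x) \<partial>\<eta>) - (cross A (\<lambda>w. measure \<eta> (cyl X w)) m n + n * P)\<bar> \<le> ln C"
proof -
  interpret l: borel_prob_on \<eta> X by fact
  define g where "g x = (\<Sum>w\<in>wlists A n. ln (m w) * indicator (cyl X w) x)" for x
  have g: "g x = ln (m (prefix x n))" if "x \<in> X" for x
  proof -
    have "indicator (cyl X w) x = (if prefix x n = w then 1 else 0 :: real)" if "w \<in> wlists A n" for w
      using wlists_length[OF that] \<open>x \<in> X\<close> by (auto simp: indicator_def in_cyl_iff)
    then have "g x = (\<Sum>w\<in>wlists A n. if prefix x n = w then ln (m w) else 0)"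
      unfolding g_def by (intro sum.cong refl) auto
    then show ?thesis
      using prefix_in_wlists[OF that] by (simp add: finite_wlists finite_A sum.delta')
  qed
  have ind: "integrable \<eta> (indicator (cyl X w) :: _ \<Rightarrow> real)" for w
    by (simp add: l.emeasure_eq_measure)
  have int_g: "integrable \<eta> g" unfolding g_def using ind by (intro Bochner_Integration.integrable_sum) auto
  have g_eq: "(\<integral>x. g x \<partial>\<eta>) = cross A (\<lambda>w. measure \<eta> (cyl X w)) m n"
  proof -
    have "(\<integral>x. ln (m w) * indicator (cyl X w) x \<partial>\<eta>) = measure \<eta> (cyl X w) * ln (m w)" for w
    proof -
      have "cyl X w \<inter> X = cyl X w" by (auto simp: cyl_def)
      then show ?thesis by (simp add: l.space_eq)
    qed
    then show ?thesis
      unfolding g_def cross_def using ind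
      by (subst Bochner_Integration.integral_sum) (auto simp: mult.commute)
  qed
  have "continuous_on X (\<lambda>x. ln (\<phi> n x))"
    using potential n less_imp_neq[OF \<phi>_pos[OF _ n]]
    by (intro continuous_on_ln) (auto simp: potential_def)
  then have "(\<lambda>x. ln (\<phi> n x)) \<in> borel_measurable (borel_on X)"
    unfolding borel_on_def by (rule borel_measurable_continuous_on_restrict)
  then have meas: "(\<lambda>x. ln (\<phi> n x)) \<in> borel_measurable \<eta>"
    by (simp add: measurable_cong_sets[OF l.sets_eq refl])
  define d where "d x = ln (\<phi> n x) - g x - n * P" for x
  have d: "\<bar>d x\<bar> \<le> ln C" if "x \<in> space \<eta>" for x
    using ln_\<phi>_bound[OF _ n, of x] that by (simp add: d_def g l.space_eq diff_diff_eq)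
  have "d \<in> borel_measurable \<eta>"
    unfolding d_def using meas int_g by (intro borel_measurable_diff) auto
  then have int_d: "integrable \<eta> d" using d by (intro l.integrable_const_bound[of _ "ln C"]) auto
  have "(\<lambda>x. ln (\<phi> n x)) = (\<lambda>x. d x + g x + n * P)" by (simp add: d_def)
  then have "(\<integral>x. ln (\<phi> n x) \<partial>\<eta>) = (\<integral>x. d x \<partial>\<eta>) + cross A (\<lambda>w. measure \<eta> (cyl X w)) m n + n * P"
    using int_d int_g g_eq l.prob_space by simp
  moreover have "\<bar>\<integral>x. d x \<partial>\<eta>\<bar> \<le> ln C"
  proof -
    have "\<bar>\<integral>x. d x \<partial>\<eta>\<bar> \<le> (\<integral>x. \<bar>d x\<bar> \<partial>\<eta>)" by (rule integral_abs_bound)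
    also have "\<dots> \<le> (\<integral>x. ln C \<partial>\<eta>)" using int_d d by (intro integral_mono) auto
    finally show ?thesis using l.prob_space by simp
  qed
  ultimately show ?thesis by simp
qed

text \<open>Free energy is \<open>P\<close> minus the relative entropy rate of \<open>\<eta>\<close>
  with respect to \<open>m\<close>, so it is at most \<open>P\<close>, and maximality means rate 0.
  The cross rate may be minus infinity; finiteness of the entropy rate and of \<open>P\<close> makes
  the \<open>ereal\<close> sums legitimate.\<close>

lemma free_energy_eq:
  assumes "invariant_on \<eta> X A"
  shows "free_energy X \<phi> \<eta> = ereal (shift_process.ent_rate A (\<lambda>w. measure \<eta> (cyl X w)))
    + m.cross_rate (\<lambda>w. measure \<eta> (cyl X w)) + ereal P"
proof -
  interpret l: invariant_on \<eta> X A by fact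
  define e where "e n = ((\<integral>x. ln (\<phi> n x) \<partial>\<eta>) - cross A l.m m n) / real n" for n
  have e_bound: "\<bar>e n - P\<bar> \<le> ln C / n" if "n \<ge> 1" for n
  proof -
    have "e n - P = ((\<integral>x. ln (\<phi> n x) \<partial>\<eta>) - (cross A l.m m n + n * P)) / n"
      using that by (simp add: e_def field_simps)
    then show ?thesis using integral_ln_\<phi>[OF l.borel_prob_on_axioms that] by (simp add: divide_right_mono)
  qed
  have "(\<lambda>n. e n - P) \<longlonglongrightarrow> 0"
    by (rule tendsto_0_le[OF lim_const_over_n[of "ln C"], of _ 1])
      (use e_bound C_ge_1 in \<open>auto intro!: eventually_sequentiallyI[of 1]\<close>)
  then have "(\<lambda>n. ereal (e n)) \<longlonglongrightarrow> ereal P" unfolding lim_ereal using LIM_zero_cancel by blast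
  then have "(\<lambda>n. ereal (cross A l.m m n / real n) + ereal (e n)) \<longlonglongrightarrow> m.cross_rate l.m + ereal P"
    using m.cross_tendsto[OF l.shift_process abs_cont] by (intro tendsto_add_ereal_general1) auto
  moreover have "ereal (cross A l.m m n / real n) + ereal (e n) = ereal ((\<integral>x. ln (\<phi> n x) \<partial>\<eta>) / real n)" for n
    by (simp add: e_def diff_divide_distrib)
  ultimately have "Lim sequentially (\<lambda>n. ereal ((\<integral>x. ln (\<phi> n x) \<partial>\<eta>) / real n)) = m.cross_rate l.m + ereal P"
    by (intro tendsto_Lim) auto
  then show ?thesis by (simp add: free_energy_def l.entropy_ms_eq add.assoc)
qed

lemma invariant_on_of: "\<eta> \<in> invariant_measures X \<Longrightarrow> invariant_on \<eta> X A"
  by (rule invariant_onI) (use closed_X shift_X finite_A range_A in auto)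

lemma invariant_measure: "\<mu> \<in> invariant_measures X"
  using sets_eq invariant prob_space_axioms
  by (simp add: invariant_measures_def borel_prob_def emeasure_eq_measure)

lemma free_energy_le: 
  assumes "\<eta> \<in> invariant_measures X"
  shows "free_energy X \<phi> \<eta> \<le> ereal P"
proof -
  interpret l: invariant_on \<eta> X A by (rule invariant_on_of[OF assms])
  show ?thesis
    using add_right_mono[OF m.ent_plus_cross_rate[OF l.shift_process abs_cont], of "ereal P"]
    by (simp add: free_energy_eq[OF l.invariant_on_axioms])
qed

lemma free_energy_self: "free_energy X \<phi> \<mu> = ereal P"
  by (simp add: free_energy_eq[OF invariant_on_axioms] m.ent_plus_cross_rate_self)

lemma var_sup_eq: "var_sup X \<phi> = ereal P"
  unfolding var_sup_def
  by (intro antisym SUP_least free_energy_le SUP_upper2[OF invariant_measure]) (auto simp: free_energy_self)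

lemma equilibrium_state: "equilibrium_state X \<phi> \<mu>"
  by (simp add: equilibrium_state_def invariant_measure free_energy_self var_sup_eq)

lemma eq_if_cyl_eq:
  assumes l: "invariant_on \<eta> X A" and eq: "\<And>w. w \<in> lists A \<Longrightarrow> measure \<eta> (cyl X w) = m w"
  shows "\<eta> = \<mu>"
proof -
  interpret l: invariant_on \<eta> X A by fact
  show ?thesis
  proof (rule borel_prob_eqI[OF l.borel_prob_on_axioms borel_prob_on_axioms])
    fix w
    show "measure \<eta> (cyl X w) = m w"
    proof (cases "w \<in> lists A")
      case False
      then have "cyl X w = {}"
        by (metis equals0I in_cyl_iff in_wlists_lists prefix_in_wlists)
      then show ?thesis by simp
    qed (rule eq)
  qed
qed

lemma equilibrium_state_unique:
  assumes "equilibrium_state X \<phi> \<eta>"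
  shows "\<eta> = \<mu>"
proof -
  have inv: "\<eta> \<in> invariant_measures X" and P: "free_energy X \<phi> \<eta> = ereal P"
    using assms by (auto simp: equilibrium_state_def var_sup_eq)
  interpret l: invariant_on \<eta> X A by (rule invariant_on_of[OF inv])
  let ?r = "ereal l.m.ent_rate + m.cross_rate l.m"
  have "?r + ereal P = ereal P" using P free_energy_eq[OF l.invariant_on_axioms] by simp
  then have "?r = 0" by (cases ?r) (auto simp: zero_ereal_def)
  from m.eq_if_ent_plus_cross_rate_zero[OF l.shift_process abs_cont this]
  show ?thesis by (intro eq_if_cyl_eq l.invariant_on_axioms)
qed

lemma gibbs_unique:
  assumes "\<eta> \<in> invariant_measures X" "gibbs X \<phi> \<eta>" and P: "pressure X \<phi> = ereal P"
  shows "\<eta> = \<mu>"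
proof -
  interpret l: invariant_on \<eta> X A by (rule invariant_on_of[OF assms(1)])
  obtain C0 where C0: "C0 > 0"
    and gibbs: "\<And>x n. x \<in> X \<Longrightarrow> n \<ge> 1 \<Longrightarrow> l.m (prefix x n) / (exp (- real n * P) * \<phi> n x) < C0"
    using assms(2) P unfolding gibbs_def by auto
  \<comment> \<open>\<open>max 1\<close> covers the empty word, about which the Gibbs inequalities,
    stated for \<open>n >= 1\<close>, say nothing.\<close>
  define D where "D = max 1 (C0 * C)"
  have D: "l.m w \<le> D * m w" for w
  proof (cases "cyl X w = {}")
    case False
    then obtain x where x: "x \<in> X" "prefix x (length w) = w" by (auto simp: in_cyl_iff)
    show ?thesis
    proof (cases "length w = 0")
      case True
      then show ?thesis using m.m_Nil l.m.m_Nil by (simp add: D_def)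
    next
      case False
      then have n: "length w \<ge> 1" by (simp add: Suc_le_eq)
      have "l.m w \<le> C0 * (exp (- (length w * P)) * \<phi> (length w) x)"
        using gibbs[OF x(1) n] \<phi>_pos[OF x(1) n] x(2) by (simp add: field_simps)
      also have "\<dots> \<le> C0 * (exp (- (length w * P)) * (C * exp (length w * P) * m w))"
        using gibbs_lower[OF x(1) n] C0 x(2) by (intro mult_left_mono) auto
      also have "\<dots> = C0 * C * m w" by (simp add: exp_minus field_simps)
      also have "\<dots> \<le> D * m w" by (intro mult_right_mono) (auto simp: D_def)
      finally show ?thesis .
    qed
  qed simp
  show ?thesis
    by (rule eq_if_cyl_eq[OF l.invariant_on_axioms], rule m.eqI_dominated[OF l.shift_process D])
qed

lemma gibbs:
  assumes P: "pressure X \<phi> = ereal P"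
  shows "gibbs X \<phi> \<mu>"
  unfolding gibbs_def
\<comment> \<open>\<open>C + 1\<close> turns the non-strict bounds of the locale into the strict
  ones of \<open>gibbs\<close>.\<close>
proof (intro conjI exI[of _ "C + 1"] ballI allI impI)
  show "\<mu> \<in> borel_prob X" using invariant_measure by (simp add: invariant_measures_def)
  show "\<bar>pressure X \<phi>\<bar> \<noteq> \<infinity>" by (simp add: P)
  show "0 < C + 1" using C_pos by simp
  fix x and n :: nat assume x: "x \<in> X" and n: "1 \<le> n"
  let ?d = "exp (- real n * real_of_ereal (pressure X \<phi>)) * \<phi> n x"
  have d: "?d > 0" using \<phi>_pos[OF x n] by simp
  have "m (prefix x n) \<le> C * ?d" using gibbs_upper[OF x n] by (simp add: P mult_ac)
  also have "\<dots> < (C + 1) * ?d" using d by (intro mult_strict_right_mono) auto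
  finally show "m (prefix x n) / ?d < C + 1" using d by (simp add: divide_less_eq)
  have "?d \<le> C * m (prefix x n)"
    using mult_left_mono[OF gibbs_lower[OF x n], of "exp (- (n * P))"]
    by (simp add: P exp_minus field_simps)
  also have "\<dots> < (C + 1) * m (prefix x n)" using m_prefix_pos[OF x] by (intro mult_strict_right_mono) auto
  finally have "1 * ?d < m (prefix x n) * (C + 1)" by (simp add: mult.commute)
  then show "1 / (C + 1) < m (prefix x n) / ?d"
    using C_pos by (subst pos_less_divide_eq[OF d]) (simp add: pos_divide_less_eq)
qed

end

section \<open>Pressure from separated sets\<close>

lemma dX_greater_imp_differ:
  assumes "dX x y > \<epsilon>" "(1 / 2) ^ j \<le> \<epsilon>"
  shows "\<exists>i<j. x i \<noteq> y i"
proof -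
  have "0 < (1 / 2 :: real) ^ j" by simp
  then have "\<epsilon> > 0" using assms(2) by linarith
  then have ne: "x \<noteq> y" using assms(1) dX_def[of x x] by force
  define L where "L = (LEAST i. x i \<noteq> y i)"
  have "\<exists>i. x i \<noteq> y i" using ne by (simp add: fun_eq_iff)
  then have "x L \<noteq> y L" unfolding L_def by (rule LeastI_ex)
  moreover have "L < j"
  proof (rule ccontr)
    assume "\<not> L < j"
    then have "(1 / 2 :: real) ^ L \<le> (1 / 2) ^ j" by (intro power_decreasing) auto
    moreover have "dX x y = (1 / 2) ^ L" using ne by (simp add: dX_def L_def)
    ultimately show False using assms by linarith
  qed
  ultimately show ?thesis by blast
qed

lemma dX_eq_1: "x 0 \<noteq> y 0 \<Longrightarrow> dX x y = 1"
  by (auto simp: dX_def Least_eq_0)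

context gibbs_subshift
begin

text \<open>Separated points differ within their first \<open>n + j\<close> letters, so at most
  \<open>card A ^ j\<close> of them share a prefix of length \<open>n\<close>. This factor is
  independent of \<open>n\<close> and disappears in the growth rate.\<close>

lemma sum_separated_le:
  assumes E: "separated X n \<epsilon> E" and j: "(1 / 2) ^ j \<le> \<epsilon>" and n: "n \<ge> 1"
  shows "(\<Sum>x\<in>E. \<phi> n x) \<le> C * exp (n * P) * card A ^ j"
proof -
  have EX: "E \<subseteq> X" using E by (auto simp: separated_def)
  have inj: "inj_on (\<lambda>x. prefix x (n + j)) E"
  proof (rule inj_onI, rule ccontr)
    fix x y assume xy: "x \<in> E" "y \<in> E" "prefix x (n + j) = prefix y (n + j)" "x \<noteq> y"
    then obtain i where i: "i < n" "dX (shiftn i x) (shiftn i y) > \<epsilon>"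
      using E unfolding separated_def by blast
    from dX_greater_imp_differ[OF i(2) j] obtain l where "l < j" "x (l + i) \<noteq> y (l + i)"
      by (auto simp: shiftn_apply)
    moreover have "x (l + i) = y (l + i)"
      using xy(3) \<open>l < j\<close> i(1) by (simp add: prefix_eq_iff)
    ultimately show False by simp
  qed
  have "(\<Sum>x\<in>E. \<phi> n x) \<le> (\<Sum>x\<in>E. C * exp (n * P) * m (prefix x n))"
    using EX n by (intro sum_mono gibbs_lower) auto
  also have "\<dots> = C * exp (n * P) * (\<Sum>x\<in>E. m (take n (prefix x (n + j))))"
    by (simp add: prefix_add sum_distrib_left)
  also have "(\<Sum>x\<in>E. m (take n (prefix x (n + j)))) = (\<Sum>z\<in>(\<lambda>x. prefix x (n + j)) ` E. m (take n z))"
    using inj by (simp add: sum.reindex)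
  also have "\<dots> \<le> (\<Sum>z\<in>wlists A (n + j). m (take n z))"
    using EX by (intro sum_mono2) (auto simp: finite_wlists finite_A prefix_in_wlists)
  also have "\<dots> = (\<Sum>u\<in>wlists A n. m u * card A ^ j)"
    unfolding sum_wlists_add by (intro sum.cong refl) (simp add: wlists_length card_wlists finite_A)
  also have "\<dots> = card A ^ j" by (simp add: sum_distrib_right[symmetric] m.sum_wlists)
  finally show ?thesis using C_pos by simp
qed

text \<open>One point from each nonempty \<open>n\<close>-cylinder: two of them differ at some
  \<open>i < n\<close>, where the shifted points have distance 1. The measures of these cylinders
  sum to 1.\<close>

lemma exists_separated_ge:
  assumes \<epsilon>: "\<epsilon> < 1" and n: "n \<ge> 1"
  shows "\<exists>E. separated X n \<epsilon> E \<and> exp (n * P) / C \<le> (\<Sum>x\<in>E. \<phi> n x)"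
proof -
  have "\<forall>w\<in>words X n. \<exists>x\<in>X. prefix x n = w" by (auto simp: words_eq)
  then obtain e where e: "\<And>w. w \<in> words X n \<Longrightarrow> e w \<in> X" "\<And>w. w \<in> words X n \<Longrightarrow> prefix (e w) n = w"
    by metis
  have fin: "finite (words X n)" using words_subset finite_wlists[OF finite_A] by (rule finite_subset)
  have "separated X n \<epsilon> (e ` words X n)"
    unfolding separated_def
  proof (intro conjI ballI impI)
    fix x y assume xy: "x \<in> e ` words X n" "y \<in> e ` words X n" "x \<noteq> y"
    then have "prefix x n \<noteq> prefix y n" using e(2) by auto
    then obtain i where "i < n" "x i \<noteq> y i" by (auto simp: prefix_eq_iff)
    then show "\<exists>i<n. dX (shiftn i x) (shiftn i y) > \<epsilon>"
      using \<epsilon> dX_eq_1[of "shiftn i x" "shiftn i y"] by (auto simp: shiftn_apply)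
  qed (use e fin in auto)
  moreover have "exp (n * P) / C \<le> (\<Sum>x\<in>e ` words X n. \<phi> n x)"
  proof -
    have "(\<Sum>w\<in>words X n. m w) = (\<Sum>w\<in>wlists A n. m w)"
      using finite_wlists[OF finite_A] words_subset
      by (intro sum.mono_neutral_left) (auto simp: measure_zero_outside)
    then have "exp (n * P) / C = (\<Sum>w\<in>words X n. exp (n * P) / C * m w)"
      by (simp only: sum_distrib_left[symmetric] m.sum_wlists mult_1_right)
    also have "\<dots> \<le> (\<Sum>w\<in>words X n. \<phi> n (e w))"
    proof (rule sum_mono)
      fix w assume w: "w \<in> words X n"
      have "exp (n * P) / C * m w \<le> exp (n * P) / C * (C * exp (- (n * P)) * \<phi> n (e w))"
        using gibbs_upper[OF e(1)[OF w] n] e(2)[OF w] C_pos by (intro mult_left_mono) auto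
      also have "\<dots> = \<phi> n (e w)" using C_pos by (simp add: exp_minus field_simps)
      finally show "exp (n * P) / C * m w \<le> \<phi> n (e w)" .
    qed
    also have "\<dots> = (\<Sum>x\<in>e ` words X n. \<phi> n x)"
    proof -
      have "inj_on e (words X n)" using e(2) by (metis inj_onI)
      then show ?thesis by (simp add: sum.reindex)
    qed
    finally show ?thesis .
  qed
  ultimately show ?thesis by blast
qed

text \<open>The rate is the same for every epsilon in (0,1), so the outer limit in
  \<open>pressure\<close> is that of an eventually constant function.\<close>

lemma limsup_separated:
  assumes \<epsilon>: "0 < \<epsilon>" "\<epsilon> < 1"
  shows "limsup (\<lambda>n. ereal (ln (SUP E\<in>{E. separated X n \<epsilon> E}. \<Sum>x\<in>E. \<phi> n x) / real n)) = ereal P"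
proof -
  define Q where "Q n = (SUP E\<in>{E. separated X n \<epsilon> E}. \<Sum>x\<in>E. \<phi> n x)" for n
  obtain j where j: "(1 / 2) ^ j < \<epsilon>" using real_arch_pow_inv[of \<epsilon> "1 / 2"] \<epsilon> by auto
  have A_pos: "card A \<ge> 1"
    using nonempty range_A finite_A by (metis One_nat_def Suc_leI card_gt_0_iff empty_iff equals0I)
  have upper: "(\<Sum>x\<in>E. \<phi> n x) \<le> C * exp (n * P) * card A ^ j" if "separated X n \<epsilon> E" "n \<ge> 1" for n E
    using sum_separated_le[OF that(1) less_imp_le[OF j] that(2)] .
  have bounds: "(n * P - ln C) / n \<le> ln (Q n) / n \<and> ln (Q n) / n \<le> (n * P + (ln C + j * ln (card A))) / n"
    if n: "n \<ge> 1" for n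
  proof -
    obtain E where E: "separated X n \<epsilon> E" "exp (n * P) / C \<le> (\<Sum>x\<in>E. \<phi> n x)"
      using exists_separated_ge[OF \<epsilon>(2) n] by auto
    have "(\<Sum>x\<in>E. \<phi> n x) \<le> Q n" unfolding Q_def using E(1) upper n by (intro cSUP_upper bdd_aboveI2) auto
    then have lo: "exp (n * P) / C \<le> Q n" using E(2) by simp
    have hi: "Q n \<le> C * exp (n * P) * card A ^ j" unfolding Q_def using E(1) upper n by (intro cSUP_least) auto
    have Q_pos: "Q n > 0" using lo C_pos by (meson divide_pos_pos exp_gt_zero less_le_trans)
    have "n * P - ln C = ln (exp (n * P) / C)" using C_pos by (simp add: ln_div)
    also have "\<dots> \<le> ln (Q n)" using lo Q_pos C_pos by simp
    finally have 1: "n * P - ln C \<le> ln (Q n)" .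
    have "ln (Q n) \<le> ln (C * exp (n * P) * card A ^ j)" using hi Q_pos by simp
    also have "\<dots> = n * P + (ln C + j * ln (card A))" using C_pos A_pos by (simp add: ln_mult ln_realpow)
    finally show ?thesis using 1 by (simp add: divide_right_mono)
  qed
  have "(\<lambda>n. ln (Q n) / real n) \<longlonglongrightarrow> P"
  proof (rule tendsto_sandwich)
    have lim: "(\<lambda>n. (n * P + b) / real n) \<longlonglongrightarrow> P" for b
    proof (rule Lim_transform_eventually)
      have "(\<lambda>n. P + b / real n) \<longlonglongrightarrow> P + 0" by (intro tendsto_add tendsto_const lim_const_over_n)
      then show "(\<lambda>n. P + b / real n) \<longlonglongrightarrow> P" by simp
      show "\<forall>\<^sub>F n in sequentially. P + b / real n = (n * P + b) / real n"
        by (intro eventually_sequentiallyI[of 1]) (simp add: field_simps)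
    qed
    show "(\<lambda>n. (n * P - ln C) / real n) \<longlonglongrightarrow> P" using lim[of "- ln C"] by simp
    show "(\<lambda>n. (n * P + (ln C + j * ln (card A))) / real n) \<longlonglongrightarrow> P" by (rule lim)
  qed (use bounds in \<open>auto intro!: eventually_sequentiallyI[of 1]\<close>)
  then have "(\<lambda>n. ereal (ln (Q n) / real n)) \<longlonglongrightarrow> ereal P" by simp
  then show ?thesis unfolding Q_def by (intro lim_imp_Limsup) auto
qed

lemma pressure_eq: "pressure X \<phi> = ereal P"
  unfolding pressure_def
proof (intro tendsto_Lim tendsto_eventually)
  show "\<forall>\<^sub>F \<epsilon> in at_right 0. limsup (\<lambda>n. ereal (ln (SUP E\<in>{E. separated X n \<epsilon> E}. \<Sum>x\<in>E. \<phi> n x) / real n)) = ereal P"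
    unfolding eventually_at_right_field using limsup_separated by (intro exI[of _ 1]) auto
qed simp

end

section \<open>The two word bounds on X from almost additivity and specification\<close>

lemma language_iff: "w \<in> language X \<longleftrightarrow> cyl X w \<noteq> {}"
  unfolding cyl_eq_empty_iff by (auto simp: language_def words_def)

lemma gibbs_subshift_of_specification:
  assumes sub: "subshift k X" and spec: "has_specification X"
    and aa: "almost_additive X f" and inv: "\<mu> \<in> invariant_measures X" and gibbs: "gibbs X f \<mu>"
  shows "\<exists>c K p C. gibbs_subshift \<mu> X ((\<lambda>x. x 0) ` X) c K p f (real_of_ereal (pressure X f)) C"
proof -
  \<comment> \<open>The letters that really occur, not \<open>{1..k}\<close>: the letter map of the
    factor is controlled only on these, and its images have to be letters of
    \<open>Y\<close>.\<close>
  define A where "A = (\<lambda>x. x 0) ` X"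
  define P where "P = real_of_ereal (pressure X f)"
  have shift_X: "shift ` X \<subseteq> X" and closed: "closed X" and sub_k: "X \<subseteq> {x. \<forall>i. x i \<in> {1..k}}"
    using sub by (auto simp: subshift_def)
  have "A \<subseteq> {1..k}" using sub_k by (auto simp: A_def)
  then have fin: "finite A" by (rule finite_subset) simp
  have range_A: "x i \<in> A" if "x \<in> X" for x i
    using imageI[OF shiftn_in[OF shift_X that, of i], of "\<lambda>x. x 0"] by (simp add: A_def shiftn_apply)
  interpret invariant_on \<mu> X A by (rule invariant_onI[OF closed shift_X fin _ inv]) (rule range_A)
  have pot: "potential X f" using aa by (simp add: almost_additive_def)
  then have f_pos: "f n x > 0" if "x \<in> X" "n \<ge> 1" for n x using that by (simp add: potential_def)
  obtain a where
    a: "\<And>x i j. x \<in> X \<Longrightarrow> i \<ge> 1 \<Longrightarrow> j \<ge> 1 \<Longrightarrow> exp (- a) * f i x * f j (shiftn i x) \<le> f (i + j) x"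
    and a': "\<And>x i j. x \<in> X \<Longrightarrow> i \<ge> 1 \<Longrightarrow> j \<ge> 1 \<Longrightarrow> f (i + j) x \<le> exp a * f i x * f j (shiftn i x)"
    using aa unfolding almost_additive_def by blast
  obtain C where C: "C > 0"
    and G: "\<And>x n. x \<in> X \<Longrightarrow> n \<ge> 1 \<Longrightarrow> 1 / C < m (prefix x n) / (exp (- real n * P) * f n x)"
      "\<And>x n. x \<in> X \<Longrightarrow> n \<ge> 1 \<Longrightarrow> m (prefix x n) / (exp (- real n * P) * f n x) < C"
    using gibbs unfolding gibbs_def P_def by blast
  have lower: "f n x \<le> C * exp (n * P) * m (prefix x n)" if "x \<in> X" "n \<ge> 1" for n x
  proof -
    have "exp (- real n * P) * f n x \<le> C * m (prefix x n)"
      using G(1)[OF that] f_pos[OF that] C by (simp add: field_simps)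
    then have "exp (n * P) * (exp (- real n * P) * f n x) \<le> exp (n * P) * (C * m (prefix x n))"
      by (rule mult_left_mono) simp
    then show ?thesis by (simp add: exp_minus mult_ac)
  qed
  have upper: "m (prefix x n) \<le> C * exp (- (n * P)) * f n x" if "x \<in> X" "n \<ge> 1" for n x
    using G(2)[OF that] f_pos[OF that] by (simp add: field_simps)
  \<comment> \<open>Either comparison of \<open>m (u @ v)\<close> with \<open>m u * m v\<close> uses
    three Gibbs bounds and almost additivity once; \<open>max 1\<close> covers empty words.\<close>
  define K where "K = max 1 (C ^ 3 * exp a)"
  have K: "K \<ge> 1" by (simp add: K_def)
  have in_cyl: "cyl X (u @ v) \<noteq> {} \<Longrightarrow> \<exists>x\<in>X. prefix x (length u) = u \<and> prefix x (length u + length v) = u @ v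
      \<and> shiftn (length u) x \<in> X \<and> prefix (shiftn (length u) x) (length v) = v" for u v
    using shiftn_in[OF shift_X] by (auto simp: in_cyl_iff prefix_add)
  have append_le: "m (u @ v) \<le> K * m u * m v" for u v
  proof (cases "cyl X (u @ v) = {}")
    case False
    from in_cyl[OF this] obtain x where x: "x \<in> X" "prefix x (length u) = u"
      "prefix x (length u + length v) = u @ v" "shiftn (length u) x \<in> X" "prefix (shiftn (length u) x) (length v) = v"
      by blast
    show ?thesis
    proof (cases "u = [] \<or> v = []")
      case True
      then show ?thesis using mult_right_mono[OF K, of "m u"] mult_right_mono[OF K, of "m v"] m.m_Nil by auto
    next
      case nonempty: False
      define i j where "i = length u" and "j = length v"
      note x = x[folded i_def j_def]
      have ij: "i \<ge> 1" "j \<ge> 1" using nonempty by (simp_all add: i_def j_def Suc_le_eq)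
      have "m (u @ v) \<le> C * exp (- ((i + j) * P)) * f (i + j) x"
        using upper[OF x(1), of "i + j"] ij x(3) by simp
      also have "\<dots> \<le> C * exp (- ((i + j) * P)) * (exp a * f i x * f j (shiftn i x))"
        using a'[OF x(1) ij] C by (intro mult_left_mono) auto
      also have "\<dots> \<le> C * exp (- ((i + j) * P)) * (exp a * (C * exp (i * P) * m u) * (C * exp (j * P) * m v))"
        using lower[OF x(1) ij(1)] lower[OF x(4) ij(2)] f_pos[OF x(4) ij(2)] C x(2,5)
        by (intro mult_left_mono mult_mono) auto
      also have "\<dots> = C ^ 3 * exp a * (m u * m v)"
        by (simp add: power3_eq_cube exp_add exp_diff distrib_right exp_minus field_simps)
      also have "\<dots> \<le> K * (m u * m v)" by (intro mult_right_mono) (auto simp: K_def)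
      finally show ?thesis by (simp add: mult.assoc)
    qed
  qed (use K in simp)
  \<comment> \<open>The reverse inequality needs a point of \<open>X\<close> that reads
    \<open>u @ v\<close>; it fails for forbidden concatenations of allowed words.\<close>
  have le_append: "m u * m v \<le> K * m (u @ v)" if "cyl X (u @ v) \<noteq> {}" for u v
  proof -
    from in_cyl[OF that] obtain x where x: "x \<in> X" "prefix x (length u) = u"
      "prefix x (length u + length v) = u @ v" "shiftn (length u) x \<in> X" "prefix (shiftn (length u) x) (length v) = v"
      by blast
    show ?thesis
    proof (cases "u = [] \<or> v = []")
      case True
      then show ?thesis using mult_right_mono[OF K, of "m u"] mult_right_mono[OF K, of "m v"] m.m_Nil by auto
    next
      case nonempty: False
      define i j where "i = length u" and "j = length v"
      note x = x[folded i_def j_def]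
      have ij: "i \<ge> 1" "j \<ge> 1" using nonempty by (simp_all add: i_def j_def Suc_le_eq)
      have "m u * m v \<le> (C * exp (- (i * P)) * f i x) * (C * exp (- (j * P)) * f j (shiftn i x))"
        using upper[OF x(1) ij(1)] upper[OF x(4) ij(2)] f_pos[OF x(1) ij(1)] C x(2,5)
        by (intro mult_mono) auto
      also have "\<dots> = C ^ 2 * exp (- ((i + j) * P)) * exp a * (exp (- a) * f i x * f j (shiftn i x))"
        by (simp add: power2_eq_square exp_add exp_diff distrib_right exp_minus field_simps)
      also have "\<dots> \<le> C ^ 2 * exp (- ((i + j) * P)) * exp a * f (i + j) x"
        using a[OF x(1) ij] by (intro mult_left_mono) auto
      also have "\<dots> \<le> C ^ 2 * exp (- ((i + j) * P)) * exp a * (C * exp ((i + j) * P) * m (u @ v))"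
        using lower[OF x(1), of "i + j"] ij x(3) by (intro mult_left_mono) auto
      also have "\<dots> = C ^ 3 * exp a * m (u @ v)"
        by (simp add: power3_eq_cube power2_eq_square exp_add exp_diff exp_minus field_simps)
      also have "\<dots> \<le> K * m (u @ v)" by (intro mult_right_mono) (auto simp: K_def)
      finally show ?thesis .
    qed
  qed
  have m_pos: "m w > 0" if "cyl X w \<noteq> {}" for w
  proof (cases "w = []")
    case True
    then show ?thesis using m.m_Nil by simp
  next
    case False
    then have n: "length w \<ge> 1" by (simp add: Suc_le_eq)
    obtain x where x: "x \<in> X" "prefix x (length w) = w" using \<open>cyl X w \<noteq> {}\<close> by (auto simp: in_cyl_iff)
    have "0 < C * exp (length w * P) * m w"
      using lower[OF x(1) n] f_pos[OF x(1) n] x(2) by simp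
    then show ?thesis using C by (simp add: zero_less_mult_iff)
  qed
  obtain p where p: "\<And>u v. u \<in> language X \<Longrightarrow> v \<in> language X \<Longrightarrow> \<exists>w. length w = p \<and> u @ w @ v \<in> language X"
    using spec unfolding has_specification_def by blast
  define d where "d = Min (m ` words X p)"
  have fin_words: "finite (words X p)" using words_subset finite_wlists[OF fin] by (rule finite_subset)
  have "X \<noteq> {}" using not_empty by (simp add: space_eq)
  then have ne_words: "words X p \<noteq> {}" by (auto simp: words_eq)
  have "m w > 0" if "w \<in> words X p" for w
    using that m_pos[of w] cyl_eq_empty_iff[of X w] by (auto simp: words_def)
  then have d: "d > 0" unfolding d_def using fin_words ne_words by simp
  have d_le: "d \<le> m w" if "w \<in> words X p" for w
    unfolding d_def using fin_words that by (intro Min_le) auto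
  \<comment> \<open>Specification supplies an allowed gap word of measure at least \<open>d\<close>;
    joining it to \<open>u\<close> and to \<open>v\<close> by \<open>le_append\<close> costs a
    factor \<open>K\<close> each time.\<close>
  define c where "c = d / K\<^sup>2"
  have joint: "c * m u * m v \<le> joint A m p u v" if uv: "u \<in> lists A" "v \<in> lists A" for u v
  proof (cases "cyl X u = {} \<or> cyl X v = {}")
    case True
    then show ?thesis by (auto simp: joint_def intro!: sum_nonneg)
  next
    case False
    then obtain w where w: "length w = p" "cyl X (u @ w @ v) \<noteq> {}"
      using p[of u v] by (auto simp: language_iff)
    then have wv: "cyl X (w @ v) \<noteq> {}" and "cyl X w \<noteq> {}"
      by (auto simp: in_cyl_append[OF shift_X])
    then have ww: "w \<in> words X p" using w(1) by (simp add: cyl_eq_empty_iff)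
    have "d * (m u * m v) \<le> m w * (m u * m v)"
      by (rule mult_right_mono[OF d_le[OF ww]]) simp
    also have "\<dots> = m u * (m w * m v)" by simp
    also have "\<dots> \<le> m u * (K * m (w @ v))" by (rule mult_left_mono[OF le_append[OF wv]]) simp
    also have "\<dots> = K * (m u * m (w @ v))" by simp
    also have "\<dots> \<le> K * (K * m (u @ w @ v))" using le_append[OF w(2)] K by (intro mult_left_mono) auto
    also have "m (u @ w @ v) \<le> joint A m p u v"
      unfolding joint_def using ww words_subset by (intro member_le_sum) (auto simp: finite_wlists fin)
    then have "K * (K * m (u @ w @ v)) \<le> K\<^sup>2 * joint A m p u v"
      using K by (simp add: power2_eq_square)
    finally have "d * (m u * m v) \<le> joint A m p u v * K\<^sup>2" by (simp add: mult.commute)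
    then have "d * (m u * m v) / K\<^sup>2 \<le> joint A m p u v"
      using K by (subst pos_divide_le_eq) auto
    then show ?thesis by (simp add: c_def)
  qed
  have "gibbs_subshift \<mu> X A c K p f P C"
    using d K C pot lower upper append_le joint by unfold_locales (auto simp: c_def)
  then show ?thesis unfolding A_def P_def by blast
qed

section \<open>Factors\<close>

definition fib :: "'a set \<Rightarrow> ('a \<Rightarrow> 'b) \<Rightarrow> 'b list \<Rightarrow> 'a list set" where
  "fib A \<tau> v = {u \<in> wlists A (length v). map \<tau> u = v}"

lemma finite_fib: "finite A \<Longrightarrow> finite (fib A \<tau> v)"
  by (simp add: fib_def finite_wlists)

lemma in_fib_lists: "u \<in> fib A \<tau> v \<Longrightarrow> u \<in> lists A"
  by (auto simp: fib_def wlists_def)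

lemma sum_fib_append:
  "(\<Sum>z\<in>fib A \<tau> (v @ w). h z) = (\<Sum>x\<in>fib A \<tau> v. \<Sum>y\<in>fib A \<tau> w. h (x @ y))"
proof -
  have "(\<Sum>x\<in>fib A \<tau> v. \<Sum>y\<in>fib A \<tau> w. h (x @ y)) = (\<Sum>(x, y)\<in>fib A \<tau> v \<times> fib A \<tau> w. h (x @ y))"
    by (rule sum.cartesian_product)
  also have "\<dots> = (\<Sum>z\<in>fib A \<tau> (v @ w). h z)"
    by (rule sum.reindex_bij_witness[where i = "\<lambda>z. (take (length v) z, drop (length v) z)" and j = "\<lambda>(x, y). x @ y"])
       (auto simp: fib_def wlists_def take_map[symmetric] drop_map[symmetric] dest: in_set_takeD in_set_dropD)
  finally show ?thesis by simp
qed

lemma sum_fib: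
  assumes "finite A" "finite B" "\<tau> ` A \<subseteq> B"
  shows "(\<Sum>w\<in>wlists B q. \<Sum>x\<in>fib A \<tau> w. h x) = (\<Sum>x\<in>wlists A q. h x)"
proof -
  have "(\<Sum>w\<in>wlists B q. \<Sum>x\<in>fib A \<tau> w. h x) = (\<Sum>w\<in>wlists B q. \<Sum>x\<in>{x \<in> wlists A q. map \<tau> x = w}. h x)"
    by (intro sum.cong refl) (simp add: fib_def wlists_length)
  also have "\<dots> = (\<Sum>x\<in>wlists A q. h x)"
    using assms(3) by (intro sum.group finite_wlists assms) (auto simp: wlists_def image_subset_iff)
  finally show ?thesis .
qed

text \<open>Gap words over \<open>B\<close> together with their fibres exhaust the gap words over
  \<open>A\<close>, so only the outer blocks remain restricted to fibres.\<close>

lemma joint_fib: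
  assumes "finite A" "finite B" "\<tau> ` A \<subseteq> B" and u: "u \<in> lists B" and v: "v \<in> lists B"
    and m': "\<And>v. v \<in> lists B \<Longrightarrow> m' v = (\<Sum>x\<in>fib A \<tau> v. m x)"
  shows "joint B m' q u v = (\<Sum>x\<in>fib A \<tau> u. \<Sum>y\<in>fib A \<tau> v. joint A m q x y)"
proof -
  have "joint B m' q u v = (\<Sum>w\<in>wlists B q. \<Sum>x\<in>fib A \<tau> u. \<Sum>z\<in>fib A \<tau> w. \<Sum>y\<in>fib A \<tau> v. m (x @ z @ y))"
    unfolding joint_def using u v
    by (intro sum.cong refl) (simp add: m' in_wlists_lists sum_fib_append)
  also have "\<dots> = (\<Sum>x\<in>fib A \<tau> u. \<Sum>w\<in>wlists B q. \<Sum>z\<in>fib A \<tau> w. \<Sum>y\<in>fib A \<tau> v. m (x @ z @ y))"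
    by (rule sum.swap)
  also have "\<dots> = (\<Sum>x\<in>fib A \<tau> u. \<Sum>z\<in>wlists A q. \<Sum>y\<in>fib A \<tau> v. m (x @ z @ y))"
    by (simp only: sum_fib[OF assms(1-3)])
  also have "\<dots> = (\<Sum>x\<in>fib A \<tau> u. \<Sum>y\<in>fib A \<tau> v. joint A m q x y)"
    unfolding joint_def by (rule sum.cong[OF refl]) (rule sum.swap)
  finally show ?thesis .
qed

text \<open>Both bounds hold for all pairs of words and are bilinear in the measures of the blocks,
  so they can be summed over two fibres with unchanged constants.\<close>

lemma mixing_process_image:
  assumes mp: "mixing_process A m c K p" and B: "\<tau> ` A \<subseteq> B" and sp: "shift_process B m'"
    and m': "\<And>v. v \<in> lists B \<Longrightarrow> m' v = (\<Sum>x\<in>fib A \<tau> v. m x)"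
  shows "mixing_process B m' c K p"
proof -
  interpret m: mixing_process A m c K p by fact
  interpret m': shift_process B m' by fact
  show ?thesis
  proof
    fix u v assume uv: "u \<in> lists B" "v \<in> lists B"
    have "c * m' u * m' v = (\<Sum>x\<in>fib A \<tau> u. \<Sum>y\<in>fib A \<tau> v. c * m x * m y)"
      by (simp only: m' uv mult.assoc sum_product) (simp only: sum_distrib_left)
    also have "\<dots> \<le> (\<Sum>x\<in>fib A \<tau> u. \<Sum>y\<in>fib A \<tau> v. joint A m p x y)"
      by (intro sum_mono m.joint_ge in_fib_lists)
    also have "\<dots> = joint B m' p u v"
      by (rule joint_fib[OF m.finite_A m'.finite_A B uv m', symmetric])
    finally show "c * m' u * m' v \<le> joint B m' p u v" .
    have "m' (u @ v) = (\<Sum>x\<in>fib A \<tau> u. \<Sum>y\<in>fib A \<tau> v. m (x @ y))"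
      using uv by (simp add: m' sum_fib_append)
    also have "\<dots> \<le> (\<Sum>x\<in>fib A \<tau> u. \<Sum>y\<in>fib A \<tau> v. K * m x * m y)"
      by (intro sum_mono m.append_le_mult in_fib_lists)
    also have "\<dots> = K * m' u * m' v"
      by (simp only: m' uv mult.assoc sum_product) (simp only: sum_distrib_left)
    finally show "m' (u @ v) \<le> K * m' u * m' v" .
  qed (rule m.c_pos m.K_pos)+
qed

lemma prefix_comp: "prefix (\<tau> \<circ> x) n = map \<tau> (prefix x n)"
  by (simp add: prefix_def)

lemma continuous_on_if_prefix_determined:
  fixes h :: "(nat \<Rightarrow> nat) \<Rightarrow> real"
  assumes "\<And>y z. y \<in> Y \<Longrightarrow> z \<in> Y \<Longrightarrow> prefix y n = prefix z n \<Longrightarrow> h y = h z"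
  shows "continuous_on Y h"
  unfolding continuous_on_def
proof (intro ballI tendsto_eventually)
  fix y assume y: "y \<in> Y"
  show "\<forall>\<^sub>F z in at y within Y. h z = h y"
    unfolding eventually_at_topological
    using assms[OF _ y] by (intro exI[of _ "cyl UNIV (prefix y n)"]) (auto simp: open_cyl_UNIV in_cyl_iff)
qed

lemma sets_vimage_shift:
  assumes "shift ` X \<subseteq> X" "B \<in> sets (borel_on X)"
  shows "shift -` B \<inter> X \<in> sets (borel_on X)"
  using measurable_sets[OF shift_measurable[OF assms(1)] assms(2)] by (simp add: space_borel_on)

text \<open>The image measure of a cylinder sums \<open>m\<close> over a fibre, and
  \<open>gpot\<close> sums values of \<open>f\<close> over the same words, so the Gibbs inequalities
  add up with the same \<open>C\<close> and \<open>P\<close>.\<close>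

lemma gibbs_subshift_factor:
  assumes gX: "gibbs_subshift \<mu> X A c K p f P C"
    and Y: "closed Y" "shift ` Y \<subseteq> Y" and B: "finite B" "\<And>y i. y \<in> Y \<Longrightarrow> y i \<in> B"
    and A: "A = (\<lambda>x. x 0) ` X" and factor: "factor_map X Y \<pi>"
  shows "gibbs_subshift (distr \<mu> (borel_on Y) \<pi>) Y B c K p (gpot X Y \<pi> f) P C"
proof -
  interpret gibbs_subshift \<mu> X A c K p f P C by fact
  obtain \<tau> where \<tau>: "\<And>x. x \<in> X \<Longrightarrow> \<pi> x = \<tau> \<circ> x" and img: "\<pi> ` X = Y" and cont: "continuous_on X \<pi>"
    and comm: "\<And>x. x \<in> X \<Longrightarrow> \<pi> (shift x) = shift (\<pi> x)"
    using factor unfolding factor_map_def by blast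
  have \<tau>A: "\<tau> ` A \<subseteq> B"
  proof
    fix b assume "b \<in> \<tau> ` A"
    then obtain x where x: "x \<in> X" "b = \<tau> (x 0)" using A by auto
    then have "b = \<pi> x 0" by (simp add: \<tau>)
    then show "b \<in> B" using B(2)[of "\<pi> x" 0] img x(1) by auto
  qed
  have prefix_\<pi>: "prefix (\<pi> x) n = map \<tau> (prefix x n)" if "x \<in> X" for x n
    by (simp add: \<tau>[OF that] prefix_comp)
  have "\<pi> \<in> borel_measurable (borel_on X)"
    unfolding borel_on_def by (rule borel_measurable_continuous_on_restrict[OF cont])
  then have "\<pi> \<in> measurable (borel_on X) (borel_on Y)"
    using img unfolding borel_on_def[of Y]
    by (intro measurable_restrict_space2) (auto simp: space_borel_on)
  then have meas: "\<pi> \<in> measurable \<mu> (borel_on Y)" by (simp only: measurable_cong_sets[OF sets_eq refl])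
  define \<nu> where "\<nu> = distr \<mu> (borel_on Y) \<pi>"
  have sets_\<nu>: "sets \<nu> = sets (borel_on Y)" by (simp add: \<nu>_def)
  have measure_\<nu>: "measure \<nu> S = measure \<mu> (\<pi> -` S \<inter> X)" if "S \<in> sets (borel_on Y)" for S
    unfolding \<nu>_def using measure_distr[OF meas that] by (simp add: space_eq)
  have "prob_space \<nu>" unfolding \<nu>_def using meas by (rule prob_space_distr)
  then interpret \<nu>: borel_prob_on \<nu> Y
    using Y(1) sets_\<nu> by (intro borel_prob_onI) (auto simp: borel_prob_def)
  interpret \<nu>: invariant_on \<nu> Y B
  proof
    fix S assume S: "S \<in> sets \<nu>"
    then have S': "S \<in> sets (borel_on Y)" by (simp add: sets_\<nu>)
    have "measure \<nu> (shift -` S \<inter> Y) = measure \<mu> (\<pi> -` (shift -` S \<inter> Y) \<inter> X)"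
      by (rule measure_\<nu>[OF sets_vimage_shift[OF Y(2) S']])
    also have "\<pi> -` (shift -` S \<inter> Y) \<inter> X = shift -` (\<pi> -` S \<inter> X) \<inter> X"
      using shift_in img comm by auto
    also have "measure \<mu> \<dots> = measure \<mu> (\<pi> -` S \<inter> X)"
      using measurable_sets[OF meas S'] by (intro invariant) (simp add: space_eq)
    also have "\<dots> = measure \<nu> S" by (rule measure_\<nu>[OF S', symmetric])
    finally show "measure \<nu> (shift -` S \<inter> Y) = measure \<nu> S" .
  qed (use Y B in auto)
  have m\<nu>: "\<nu>.m v = (\<Sum>x\<in>fib A \<tau> v. m x)" for v
  proof -
    define S where "S = \<pi> -` cyl Y v \<inter> X"
    have mS: "\<nu>.m v = measure \<mu> S" 
      unfolding S_def by (rule measure_\<nu>) (use \<nu>.cyl_sets sets_\<nu> in auto)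
    have "S \<in> sets \<mu>"
      unfolding S_def using measurable_sets[OF meas, of "cyl Y v"] \<nu>.cyl_sets sets_\<nu> by (simp add: space_eq)
    moreover have split: "S \<inter> (\<lambda>x. prefix x (length v)) -` {u} = cyl X u" if "u \<in> fib A \<tau> v" for u
    proof -
      have "length u = length v" "map \<tau> u = v" using that by (auto simp: fib_def wlists_def)
      then show ?thesis using img by (auto simp: S_def in_cyl_iff prefix_\<pi>)
    qed
    moreover have "prefix x (length v) \<in> fib A \<tau> v" if "x \<in> S" for x
      using that by (auto simp: S_def in_cyl_iff prefix_\<pi> fib_def prefix_in_wlists)
    ultimately have "measure \<mu> S = (\<Sum>u\<in>fib A \<tau> v. measure \<mu> (S \<inter> (\<lambda>x. prefix x (length v)) -` {u}))"
      by (intro measure_partition) (auto simp: finite_fib finite_A)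
    also have "\<dots> = (\<Sum>u\<in>fib A \<tau> v. m u)" by (intro sum.cong refl) (simp add: split)
    finally show ?thesis using mS by simp
  qed
  interpret \<nu>: mixing_on \<nu> Y B c K p
    using \<nu>.invariant_on_axioms mixing_process_image[OF mixing_process \<tau>A \<nu>.shift_process m\<nu>]
    by (intro mixing_on.intro mixing_on_axioms.intro)
  define F where "F n y = fiber_words X Y \<pi> n y" for n y
  \<comment> \<open>Cylinders of words in \<open>words X n\<close> are nonempty and
    \<open>\<pi>\<close> acts letterwise, so one point decides the inclusion in
    \<open>fiber_words\<close>.\<close>
  have F_eq: "F n y = fib A \<tau> (prefix y n) \<inter> words X n" for n y
  proof -
    have "\<pi> ` cyl X w \<subseteq> cyl Y (prefix y n) \<longleftrightarrow> map \<tau> w = prefix y n" if w: "w \<in> words X n" for w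
    proof -
      have len: "length w = n" using w by (auto simp: words_def)
      then obtain x0 where "x0 \<in> cyl X w" using w cyl_eq_empty_iff[of X w] by auto
      moreover have "\<pi> x \<in> cyl Y (prefix y n) \<longleftrightarrow> map \<tau> w = prefix y n" if "x \<in> cyl X w" for x
        using that len img by (auto simp: in_cyl_iff prefix_\<pi>)
      ultimately show ?thesis by blast
    qed
    then show ?thesis using words_subset[of n] by (auto simp: F_def fiber_words_def fib_def)
  qed
  have fin_F: "finite (F n y)" for n y by (simp add: F_eq finite_fib finite_A)
  have m\<nu>_F: "\<nu>.m (prefix y n) = (\<Sum>w\<in>F n y. m w)" for n y
    unfolding m\<nu> F_eq
    using measure_zero_outside
    by (intro sum.mono_neutral_right finite_fib finite_A) (auto simp: fib_def)
  define G where "G n y = gpot X Y \<pi> f n y" for n y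
  define E where "E n y = (\<Pi> w\<in>F n y. cyl X w)" for n y
  have G_eq: "G n y = (SUP e\<in>E n y. \<Sum>w\<in>F n y. f n (e w))" for n y
    by (simp add: G_def gpot_def F_def E_def)
  have e_props: "e w \<in> X \<and> prefix (e w) n = w" if "e \<in> E n y" "w \<in> F n y" for e w n y
    using that by (auto simp: E_def F_eq words_def Pi_iff in_cyl_iff)
  have "\<exists>e. e \<in> E n y" for n y
  proof -
    have "\<forall>w\<in>F n y. \<exists>x. x \<in> cyl X w"
      using cyl_eq_empty_iff[of X] by (auto simp: F_eq words_def) blast
    then show ?thesis by (auto simp: E_def Pi_iff Ball_def) metis
  qed
  then have E_ne: "E n y \<noteq> {}" for n y by blast
  have sum_le: "(\<Sum>w\<in>F n y. f n (e w)) \<le> C * exp (n * P) * \<nu>.m (prefix y n)"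
    if "e \<in> E n y" "n \<ge> 1" for e n y
  proof -
    have "(\<Sum>w\<in>F n y. f n (e w)) \<le> (\<Sum>w\<in>F n y. C * exp (n * P) * m w)"
      using gibbs_lower[OF _ that(2)] e_props[OF that(1)] by (intro sum_mono) metis
    then show ?thesis by (simp add: m\<nu>_F sum_distrib_left)
  qed
  have G_le: "G n y \<le> C * exp (n * P) * \<nu>.m (prefix y n)" if "n \<ge> 1" for n y
    unfolding G_eq by (intro cSUP_least E_ne sum_le that)
  \<comment> \<open>Any single selection already satisfies the bound; \<open>sum_le\<close> makes
    the family bounded, so the supremum lies above that selection.\<close>
  have G_ge: "\<nu>.m (prefix y n) \<le> C * exp (- (n * P)) * G n y" if "n \<ge> 1" for n y
  proof -
    obtain e where e: "e \<in> E n y" using E_ne by blast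
    have "\<nu>.m (prefix y n) \<le> (\<Sum>w\<in>F n y. C * exp (- (n * P)) * f n (e w))"
      unfolding m\<nu>_F using gibbs_upper[OF _ that] e_props[OF e] by (intro sum_mono) metis
    also have "\<dots> = C * exp (- (n * P)) * (\<Sum>w\<in>F n y. f n (e w))" by (simp add: sum_distrib_left)
    also have "\<dots> \<le> C * exp (- (n * P)) * G n y"
      unfolding G_eq using C_pos e sum_le that
      by (intro mult_left_mono cSUP_upper bdd_aboveI2[where M = "C * exp (n * P) * \<nu>.m (prefix y n)"]) auto
    finally show ?thesis .
  qed
  have "potential Y G"
    unfolding potential_def
  proof (intro allI impI conjI ballI)
    fix n :: nat assume n: "n \<ge> 1"
    \<comment> \<open>\<open>G n y\<close> depends on \<open>y\<close> only through its first
      \<open>n\<close> letters, so it is locally constant.\<close>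
    show "continuous_on Y (G n)"
    proof (rule continuous_on_if_prefix_determined[of _ n])
      fix y z assume "prefix y n = prefix z n"
      then have "F n y = F n z" by (simp add: F_eq)
      then show "G n y = G n z" by (simp add: G_eq E_def)
    qed
    \<comment> \<open>By surjectivity \<open>y\<close> has a preimage, whose prefix lies in the
      fibre and has positive measure; this forces positivity of \<open>G n y\<close>.\<close>
    fix y assume "y \<in> Y"
    then obtain x where x: "x \<in> X" "y = \<pi> x" using img by auto
    have "prefix x n \<in> fib A \<tau> (prefix y n)"
      using x by (simp add: fib_def prefix_\<pi> prefix_in_wlists)
    then have "m (prefix x n) \<le> \<nu>.m (prefix y n)"
      unfolding m\<nu> by (intro member_le_sum) (auto simp: finite_fib finite_A)
    then have "0 < C * exp (- (n * P)) * G n y"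
      using m_prefix_pos[OF x(1), of n] G_ge[OF n, of y] by linarith
    then show "G n y > 0" by (rule zero_less_mult_pos) (simp add: C_pos)
  qed
  then have "gibbs_subshift \<nu> Y B c K p G P C"
    using C_pos G_le G_ge by unfold_locales auto
  moreover have "G = gpot X Y \<pi> f" by (simp add: G_def fun_eq_iff)
  ultimately show ?thesis by (simp add: \<nu>_def)
qed

theorem theorem3p1:
  fixes k k' :: nat
    and X Y :: "(nat \<Rightarrow> nat) set"
    and \<pi> :: "(nat \<Rightarrow> nat) \<Rightarrow> (nat \<Rightarrow> nat)"
    and f :: "nat \<Rightarrow> (nat \<Rightarrow> nat) \<Rightarrow> real"
    and \<mu> :: "(nat \<Rightarrow> nat) measure"
  assumes "subshift k X" and "subshift k' Y"
    and "factor_map X Y \<pi>"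
    and "has_specification X"
    and "almost_additive X f" and "bounded_variation X f"
    and "\<mu> \<in> invariant_measures X" and "gibbs X f \<mu>"
    and "\<forall>\<mu>'\<in>invariant_measures X. gibbs X f \<mu>' \<longrightarrow> \<mu>' = \<mu>"
  defines "\<nu> \<equiv> distr \<mu> (borel_on Y) \<pi>"
    and "g \<equiv> gpot X Y \<pi> f"
  shows "asymp_subadditive Y g \<and> bounded_variation Y g
    \<and> \<nu> \<in> invariant_measures Y \<and> gibbs Y g \<nu>
    \<and> (\<forall>\<nu>'\<in>invariant_measures Y. gibbs Y g \<nu>' \<longrightarrow> \<nu>' = \<nu>)
    \<and> equilibrium_state Y g \<nu> \<and> (\<forall>\<nu>'. equilibrium_state Y g \<nu>' \<longrightarrow> \<nu>' = \<nu>)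
    \<and> mixing Y \<nu>
    \<and> pressure X f = var_sup X f \<and> var_sup X f = var_sup Y g \<and> var_sup Y g = pressure Y g"
proof -
  obtain c K p C where X: "gibbs_subshift \<mu> X ((\<lambda>x. x 0) ` X) c K p f (real_of_ereal (pressure X f)) C"
    using gibbs_subshift_of_specification[OF assms(1,4,5,7,8)] by blast
  then interpret X: gibbs_subshift \<mu> X "(\<lambda>x. x 0) ` X" c K p f "real_of_ereal (pressure X f)" C .
  \<comment> \<open>\<open>Y\<close> inherits the parameter of \<open>X\<close>, so
    \<open>Y.pressure_eq\<close> and \<open>Y.var_sup_eq\<close> identify pressure and variational
    supremum of \<open>g\<close> with the pressure of \<open>f\<close>.\<close>
  interpret Y: gibbs_subshift \<nu> Y "{1..k'}" c K p g "real_of_ereal (pressure X f)" C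
    unfolding \<nu>_def g_def
    by (rule gibbs_subshift_factor[OF X]) (use assms(2,3) in \<open>auto simp: subshift_def\<close>)
  show ?thesis
  proof (intro conjI ballI allI impI)
    show "\<nu>' = \<nu>" if "\<nu>' \<in> invariant_measures Y" "gibbs Y g \<nu>'" for \<nu>'
      using Y.gibbs_unique[OF that Y.pressure_eq] .
    show "\<nu>' = \<nu>" if "equilibrium_state Y g \<nu>'" for \<nu>'
      using Y.equilibrium_state_unique[OF that] .
    show "pressure X f = var_sup X f"
      unfolding X.var_sup_eq by (rule X.pressure_eq)
  qed (simp_all only: X.var_sup_eq Y.pressure_eq Y.var_sup_eq Y.asymp_subadditive Y.bounded_variation
      Y.invariant_measure Y.gibbs[OF Y.pressure_eq] Y.equilibrium_state Y.mixing)
qed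

end
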